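(* Let $m$ be an integer with $n=3m\ge 18$. Suppose that $\mathcal F_1,\mathcal F_2,\mathcal F_3\subset 2^{[n]}$ are cross partition-free. Then $$|\mathcal F_1|+|\mathcal F_2|+|\mathcal F_3|\le 3|\mathcal K(3m)|+\frac1m\binom{3m}{2m+1}.$$ Moreover, equality holds only when, after a suitable permutation of the indices of the three families, $\mathcal F_1=\{A\subset[n]: m\le|A|\le 2m+1\}$ and $\mathcal F_2=\mathcal F_3=\{B\subset[n]: m+1\le|B|\le 2m\}$.
   Context: Three families $\mathcal F_1,\mathcal F_2,\mathcal F_3\subset 2^{[n]}$ are cross partition-free if there is no choice of $A\in\mathcal F_1$, $B\in\mathcal F_2$, $C\in\mathcal F_3$ such that one of these three sets equals the disjoint union of the other two. $\mathcal K(3m):=\{K\subset[3m]: m+1\le|K|\le 2m+1\}$. *)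

theory Defs
  imports Complex_Main "HOL-Combinatorics.Permutations"
begin

definition is_disjoint_union :: "'a set \<Rightarrow> 'a set \<Rightarrow> 'a set \<Rightarrow> bool" where
  "is_disjoint_union X Y Z \<longleftrightarrow> Y \<inter> Z = {} \<and> X = Y \<union> Z"

text \<open>The sets \<open>A\<close>, \<open>B\<close>, \<open>C\<close> may be empty, and need not be distinct.\<close>

definition cross_partition_free :: "'a set set \<Rightarrow> 'a set set \<Rightarrow> 'a set set \<Rightarrow> bool" where
  "cross_partition_free F1 F2 F3 \<longleftrightarrow>
     \<not> (\<exists>A\<in>F1. \<exists>B\<in>F2. \<exists>C\<in>F3.
          is_disjoint_union A B C \<or> is_disjoint_union B A C \<or> is_disjoint_union C A B)"

definition K_family :: "nat \<Rightarrow> nat set set" where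
  "K_family m = {K. K \<subseteq> {1..3 * m} \<and> m + 1 \<le> card K \<and> card K \<le> 2 * m + 1}"

end

theory Submission
  imports Defs
begin

text \<open>
  Let \<open>D k\<close> be the sum of the densities of the three families in layer \<open>k\<close>. Averaging the forbidden pattern over
  all permutations of the ground set gives \<open>D a + D b + D (a + b) \<le> 6\<close>, so that a nonempty layer far from the middle
  \<open>m+1, \<dots>, 2m\<close> forces gaps in much larger middle layers. The layers \<open>m - 1\<close>, \<open>m\<close> and \<open>2m + 1\<close>
  need a sharper inequality, since there density considerations alone would allow every family to contain half of the \<open>m\<close>-sets.
  It comes from a partition of the ground set into sets \<open>P\<close>, \<open>Q\<close>, \<open>E\<close>, \<open>{x}\<close> of sizes
  \<open>m\<close>, \<open>m\<close>, \<open>m - 1\<close>, \<open>1\<close>: a weighted count of the memberships of the unions of these parts obeys a bound that is again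
  averaged over all permutations. The combination of these inequalities is strict as soon as a middle layer has a gap.
  In the extremal case the middle layers are therefore full and every partition is tight, which forces its three
  \<open>m\<close>-sets into one and the same family.
\<close>

subsection \<open>Averaging over permutations\<close>

lemma ex_permutes_image_eq:
  assumes "finite U" "A \<subseteq> U" "B \<subseteq> U" "card A = card B"
  obtains \<sigma> where "\<sigma> permutes U" "\<sigma> ` A = B"
proof -
  have fA: "finite A" "finite B" using assms finite_subset by blast+
  have "card (U - A) = card (U - B)" using assms fA by (simp add: card_Diff_subset)
  then obtain g where g: "bij_betw g (U - A) (U - B)"
    using assms(1) by (metis finite_Diff finite_same_card_bij)
  obtain f where f: "bij_betw f A B"
    using fA assms(4) finite_same_card_bij by blast
  define h where "h = (\<lambda>x. if x \<in> A then f x else if x \<in> U then g x else x)"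
  have hA: "bij_betw h A B" using f by (rule bij_betw_cong[THEN iffD1, rotated]) (simp add: h_def)
  have hU: "bij_betw h (U - A) (U - B)" using g by (rule bij_betw_cong[THEN iffD1, rotated]) (simp add: h_def)
  have "bij_betw h (A \<union> (U - A)) (B \<union> (U - B))" by (rule bij_betw_combine[OF hA hU]) blast
  then have "bij_betw h U U" using assms by (simp add: Un_absorb1)
  then have "h permutes U" by (rule bij_imp_permutes) (use assms(2) in \<open>auto simp: h_def\<close>)
  moreover have "h ` A = B" using hA by (simp add: bij_betw_def)
  ultimately show thesis by (rule that)
qed

text \<open>Composing on the left with a permutation that carries \<open>B\<close> to
  \<open>C\<close> injects the fibre over \<open>B\<close> into the fibre over \<open>C\<close>.
  Hence all fibres of the map sending a permutation to the image of \<open>X\<close> are equally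
  large, and there is one for each subset of \<open>U\<close> of size \<open>card X\<close>.\<close>

lemma card_permutes_image_eq:
  assumes "finite U" "X \<subseteq> U" "A \<subseteq> U" "card A = card X"
  shows "(card U choose card X) * card {\<pi>. \<pi> permutes U \<and> \<pi> ` X = A} = fact (card U)"
proof -
  let ?N = "\<lambda>B. {\<pi>. \<pi> permutes U \<and> \<pi> ` X = B}"
  let ?L = "{B. B \<subseteq> U \<and> card B = card X}"
  have fin: "finite (?N B)" for B
    by (rule finite_subset[OF _ finite_permutations[OF assms(1)]]) auto
  have finL: "finite ?L" using assms(1) by simp
  have le: "card (?N B) \<le> card (?N C)" if "B \<in> ?L" "C \<in> ?L" for B C
  proof -
    obtain \<sigma> where s: "\<sigma> permutes U" "\<sigma> ` B = C"
      using ex_permutes_image_eq[OF assms(1), of B C] \<open>B \<in> ?L\<close> \<open>C \<in> ?L\<close> by auto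
    have "inj_on (\<lambda>\<pi>. \<sigma> \<circ> \<pi>) (?N B)"
      by (rule inj_on_subset[OF fun.inj_map[OF permutes_inj[OF s(1)]]]) simp
    moreover have "(\<lambda>\<pi>. \<sigma> \<circ> \<pi>) ` ?N B \<subseteq> ?N C"
      using s by (auto simp: permutes_compose image_comp)
    ultimately show ?thesis by (rule card_inj_on_le) (rule fin)
  qed
  have "{\<pi>. \<pi> permutes U} = (\<Union>B\<in>?L. ?N B)"
  proof safe
    fix \<pi> assume p: "\<pi> permutes U"
    have "\<pi> ` X \<subseteq> U" using p assms(2) by (auto simp: permutes_in_image)
    moreover have "card (\<pi> ` X) = card X" using permutes_inj_on[OF p] by (rule card_image)
    ultimately show "\<pi> \<in> (\<Union>B\<in>?L. ?N B)" using p by auto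
  qed
  then have "fact (card U) = card (\<Union>B\<in>?L. ?N B)"
    using card_permutations[OF refl assms(1)] by simp
  also have "\<dots> = (\<Sum>B\<in>?L. card (?N B))"
    by (rule card_UN_disjoint[OF finL]) (use fin in auto)
  also have "\<dots> = (\<Sum>B\<in>?L. card (?N A))"
    by (rule sum.cong[OF refl], rule antisym) (use le assms in auto)
  also have "\<dots> = (card U choose card X) * card (?N A)"
    using n_subsets[OF assms(1), of "card X"] by simp
  finally show ?thesis by simp
qed

definition layer_density :: "'a set \<Rightarrow> 'a set set \<Rightarrow> nat \<Rightarrow> real" where
  "layer_density U G k = card {A \<in> G. card A = k} / (card U choose k)"

text \<open>A uniformly random permutation sends \<open>X\<close> to a uniformly random set of the
  same size, so the density of a layer is the probability of landing in \<open>G\<close>.\<close>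

lemma sum_permutes_layer_density:
  assumes "finite U" "X \<subseteq> U" "G \<subseteq> Pow U"
  shows "(\<Sum>\<pi> | \<pi> permutes U. of_bool (\<pi> ` X \<in> G)) = fact (card U) * layer_density U G (card X)"
proof -
  let ?N = "\<lambda>B. {\<pi>. \<pi> permutes U \<and> \<pi> ` X = B}"
  let ?L = "{B \<in> G. card B = card X}"
  have fin: "finite {\<pi>. \<pi> permutes U}" by (rule finite_permutations[OF assms(1)])
  have finL: "finite ?L" using assms(1,3) by (auto intro: finite_subset[of _ "Pow U"])
  have c0: "card U choose card X > 0" using assms(1,2) by (simp add: card_mono)
  have eq: "{\<pi>. \<pi> permutes U \<and> \<pi> ` X \<in> G} = (\<Union>B\<in>?L. ?N B)"
    by (auto simp: card_image[OF permutes_inj_on])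
  have "(\<Sum>\<pi> | \<pi> permutes U. of_bool (\<pi> ` X \<in> G)) = real (card {\<pi>. \<pi> permutes U \<and> \<pi> ` X \<in> G})"
    using fin by (simp add: of_bool_def sum.If_cases Int_def)
  also have "card {\<pi>. \<pi> permutes U \<and> \<pi> ` X \<in> G} = (\<Sum>B\<in>?L. card (?N B))"
    unfolding eq by (rule card_UN_disjoint[OF finL]) (auto intro: finite_subset[OF _ fin])
  also have "real \<dots> = (\<Sum>B\<in>?L. fact (card U) / real (card U choose card X))"
    unfolding of_nat_sum
  proof (rule sum.cong[OF refl])
    fix B assume "B \<in> ?L"
    then have "(card U choose card X) * card (?N B) = fact (card U)"
      using card_permutes_image_eq[OF assms(1,2), of B] assms(3) by auto
    then have "real (card U choose card X) * real (card (?N B)) = fact (card U)"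
      by (metis of_nat_fact of_nat_mult)
    then show "real (card (?N B)) = fact (card U) / real (card U choose card X)"
      using c0 by (simp add: field_simps)
  qed
  finally show ?thesis by (simp add: layer_density_def)
qed

subsection \<open>The local inequality\<close>

text \<open>The three sets of a forbidden pattern can be distributed over the three families in six
  ways, and a condition is needed for each of them.\<close>

definition tri :: "(nat \<Rightarrow> nat \<Rightarrow> nat \<Rightarrow> bool) \<Rightarrow> bool" where
  "tri R \<longleftrightarrow> R 1 2 3 \<and> R 1 3 2 \<and> R 2 1 3 \<and> R 2 3 1 \<and> R 3 1 2 \<and> R 3 2 1"

abbreviation tsum :: "(nat \<Rightarrow> real) \<Rightarrow> real" where
  "tsum f \<equiv> f 1 + f 2 + f 3"

text \<open>In \<open>side_bound\<close> and \<open>config_bound\<close>, \<open>a\<close>, \<open>b\<close>, \<open>t\<close>, \<open>c\<close>, \<open>e\<close> record which families contain the sets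
  \<open>P\<close>, \<open>Q\<close>, \<open>E \<union> {x}\<close>, \<open>P \<union> Q \<union> {x}\<close>, \<open>E\<close> of a partition \<open>P, Q, E, {x}\<close> of the ground set, and
  \<open>k\<close>, \<open>u\<close>, \<open>v\<close>, \<open>p\<close>, \<open>q\<close>, \<open>g\<close>, \<open>h\<close> which families miss \<open>P \<union> Q\<close>, \<open>E \<union> Q \<union> {x}\<close>, \<open>E \<union> P \<union> {x}\<close>,
  \<open>P \<union> {x}\<close>, \<open>Q \<union> {x}\<close>, \<open>E \<union> P\<close>, \<open>E \<union> Q\<close>. The weights solve the dual of a linear program. Only \<open>a\<close> and
  \<open>b\<close> have to be integral.\<close>

lemma side_bound:
  fixes a c e q u g :: "nat \<Rightarrow> real"
  assumes nonneg: "\<And>i. 0 \<le> c i" "\<And>i. 0 \<le> e i" "\<And>i. 0 \<le> q i" "\<And>i. 0 \<le> u i" "\<And>i. 0 \<le> g i"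
    and 1: "tri (\<lambda>i j l. a i + c j \<le> 1 + q l)"
    and 2: "tri (\<lambda>i j l. e i + a j \<le> 1 + g l)"
    and 3: "tri (\<lambda>i j l. e i \<le> q j + u l)"
  defines "W \<equiv> tsum c / 2 + tsum e / 2 - 9/8 * tsum q - tsum u / 2 - tsum g"
  shows "W \<le> tsum c / 2"
    and "W \<le> tsum c / 2 + tsum e / 2 - tsum u / 2"
    and "tri (\<lambda>i j l. a i = 1 \<longrightarrow> W \<le> c i / 2 - (c j + c l) / 4 - tsum u / 4)"
    and "tri (\<lambda>i j l. a i = 1 \<and> a j = 1 \<longrightarrow> W \<le> - (c i + c j) / 16 - c l - tsum u / 2)"
    and "a 1 = 1 \<and> a 2 = 1 \<and> a 3 = 1 \<longrightarrow> W \<le> - tsum c / 2 - tsum e / 2 - tsum u / 2"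
proof -
  note n = nonneg[of 1] nonneg[of 2] nonneg[of 3]
  \<comment> \<open>Half the sum of the six instances of the third condition: every index occurs
    twice in every position.\<close>
  have s: "tsum e \<le> tsum q + tsum u" using 3 unfolding tri_def by linarith
  show "W \<le> tsum c / 2" unfolding W_def using n s by argo
  show "W \<le> tsum c / 2 + tsum e / 2 - tsum u / 2" unfolding W_def using n by argo
  \<comment> \<open>Having the values of \<open>tsum\<close> in terms of \<open>i\<close>,
    \<open>j\<close>, \<open>l\<close> as hypotheses lets one linear argument serve all six
    orderings.\<close>
  have A: "W \<le> c i / 2 - (c j + c l) / 4 - tsum u / 4"
    if "a i = 1" "tsum c = c i + c j + c l" "tsum e = e i + e j + e l" "tsum q = q i + q j + q l"
       "tsum u = u i + u j + u l" "tsum g = g i + g j + g l"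
       "a i + c j \<le> 1 + q l" "a i + c l \<le> 1 + q j" "e j + a i \<le> 1 + g l" "e l + a i \<le> 1 + g j"
       "e i \<le> q j + u l" "e i \<le> q l + u j" for i j l
    unfolding W_def using that nonneg[of i] nonneg[of j] nonneg[of l] by argo
  show "tri (\<lambda>i j l. a i = 1 \<longrightarrow> W \<le> c i / 2 - (c j + c l) / 4 - tsum u / 4)"
    unfolding tri_def
    by (intro conjI impI; rule A) (use 1 2 3 in \<open>simp_all add: tri_def add_ac del: One_nat_def\<close>)
  \<comment> \<open>The single \<open>q l\<close> bounds both \<open>c i\<close> and
    \<open>c j\<close>; the weight \<open>9/8\<close> therefore leaves
    \<open>1/2 - 9/16 = -1/16\<close> on each of them.\<close>
  have B: "W \<le> - (c i + c j) / 16 - c l - tsum u / 2"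
    if "a i = 1" "a j = 1" "tsum c = c i + c j + c l" "tsum e = e i + e j + e l" "tsum q = q i + q j + q l"
       "tsum u = u i + u j + u l" "tsum g = g i + g j + g l"
       "a i + c j \<le> 1 + q l" "a j + c i \<le> 1 + q l" "a i + c l \<le> 1 + q j" "a j + c l \<le> 1 + q i"
       "e j + a i \<le> 1 + g l" "e i + a j \<le> 1 + g l"  "e l + a i \<le> 1 + g j" for i j l
    unfolding W_def using that nonneg[of i] nonneg[of j] nonneg[of l] by argo
  show "tri (\<lambda>i j l. a i = 1 \<and> a j = 1 \<longrightarrow> W \<le> - (c i + c j) / 16 - c l - tsum u / 2)"
    unfolding tri_def
    by (intro conjI impI; rule B) (use 1 2 3 in \<open>simp_all add: tri_def add_ac del: One_nat_def\<close>)
  show "a 1 = 1 \<and> a 2 = 1 \<and> a 3 = 1 \<longrightarrow> W \<le> - tsum c / 2 - tsum e / 2 - tsum u / 2"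
  proof
    assume *: "a 1 = 1 \<and> a 2 = 1 \<and> a 3 = 1"
    have "tsum c \<le> tsum q" "tsum e \<le> tsum g" using 1 2 * unfolding tri_def by linarith+
    then show "W \<le> - tsum c / 2 - tsum e / 2 - tsum u / 2" unfolding W_def using n by argo
  qed
qed

text \<open>The endpoints \<open>\<epsilon> = 0\<close> and \<open>\<epsilon> = 1/6\<close> of \<open>config_bound\<close>, which is affine in \<open>\<epsilon>\<close>.\<close>

lemma config_bound_ends:
  fixes a b t c e k u v p q g h :: "nat \<Rightarrow> real"
  assumes ab: "\<And>i. a i = 0 \<or> a i = 1" "\<And>i. b i = 0 \<or> b i = 1"
    and t: "\<And>i. 0 \<le> t i \<and> t i \<le> 1" and c: "\<And>i. 0 \<le> c i \<and> c i \<le> 1"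
    and nonneg: "\<And>i. 0 \<le> e i" "\<And>i. 0 \<le> k i" "\<And>i. 0 \<le> p i" "\<And>i. 0 \<le> q i"
      "\<And>i. 0 \<le> u i" "\<And>i. 0 \<le> v i" "\<And>i. 0 \<le> g i" "\<And>i. 0 \<le> h i"
    and abk: "tri (\<lambda>i j l. a i + b j \<le> 1 + k l)"
    and atv: "tri (\<lambda>i j l. a i + t j \<le> 1 + v l)"
    and btu: "tri (\<lambda>i j l. b i + t j \<le> 1 + u l)"
    and acq: "tri (\<lambda>i j l. a i + c j \<le> 1 + q l)" and bcp: "tri (\<lambda>i j l. b i + c j \<le> 1 + p l)"
    and eag: "tri (\<lambda>i j l. e i + a j \<le> 1 + g l)" and ebh: "tri (\<lambda>i j l. e i + b j \<le> 1 + h l)"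
    and equ: "tri (\<lambda>i j l. e i \<le> q j + u l)" and epv: "tri (\<lambda>i j l. e i \<le> p j + v l)"
  defines "W \<equiv> tsum c / 2 + tsum e / 2 - 9/8 * tsum q - tsum u / 2 - tsum g"
    and "Z \<equiv> tsum c / 2 + tsum e / 2 - 9/8 * tsum p - tsum v / 2 - tsum h"
  shows "tsum a + tsum b + W + Z \<le> 3 + tsum k"
    and "19 * tsum a + 19 * tsum b + tsum t + 18 * W + 18 * Z \<le> 57 + 20 * tsum k"
proof -
  note W = side_bound[of c e q u g a, folded W_def, OF _ _ _ _ _ acq eag equ]
  note Z = side_bound[of c e p v h b, folded Z_def, OF _ _ _ _ _ bcp ebh epv]
  have W': "W \<le> tsum c / 2" "W \<le> tsum c / 2 + tsum e / 2 - tsum u / 2"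
    "a 1 = 1 \<and> a 2 = 1 \<and> a 3 = 1 \<longrightarrow> W \<le> - tsum c / 2 - tsum e / 2 - tsum u / 2"
    "tri (\<lambda>i j l. a i = 1 \<longrightarrow> W \<le> c i / 2 - (c j + c l) / 4 - tsum u / 4)"
    "tri (\<lambda>i j l. a i = 1 \<and> a j = 1 \<longrightarrow> W \<le> - (c i + c j) / 16 - c l - tsum u / 2)"
    by (rule W; use c nonneg in blast)+
  have Z': "Z \<le> tsum c / 2" "Z \<le> tsum c / 2 + tsum e / 2 - tsum v / 2"
    "b 1 = 1 \<and> b 2 = 1 \<and> b 3 = 1 \<longrightarrow> Z \<le> - tsum c / 2 - tsum e / 2 - tsum v / 2"
    "tri (\<lambda>i j l. b i = 1 \<longrightarrow> Z \<le> c i / 2 - (c j + c l) / 4 - tsum v / 4)"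
    "tri (\<lambda>i j l. b i = 1 \<and> b j = 1 \<longrightarrow> Z \<le> - (c i + c j) / 16 - c l - tsum v / 2)"
    by (rule Z; use c nonneg in blast)+
  note n = nonneg(2)[of 1] nonneg(2)[of 2] nonneg(2)[of 3] nonneg(5)[of 1] nonneg(5)[of 2] nonneg(5)[of 3]
    nonneg(6)[of 1] nonneg(6)[of 2] nonneg(6)[of 3]
    nonneg(1)[of 1] nonneg(1)[of 2] nonneg(1)[of 3]
    t[of 1] t[of 2] t[of 3] c[of 1] c[of 2] c[of 3]
  \<comment> \<open>For each of the 64 choices of \<open>a\<close> and \<open>b\<close> on the
    indices 1, 2, 3 the remaining problem is linear.\<close>
  have "tsum a + tsum b + W + Z \<le> 3 + tsum k \<and> 19 * tsum a + 19 * tsum b + tsum t + 18 * W + 18 * Z \<le> 57 + 20 * tsum k"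
    using ab(1)[of 1] ab(1)[of 2] ab(1)[of 3] ab(2)[of 1] ab(2)[of 2] ab(2)[of 3]
    apply (elim disjE)
    apply (insert W' Z' abk atv btu n)
    apply (simp_all only: tri_def simp_thms zero_neq_one one_neq_zero)
    apply ((elim conjE, intro conjI; argo)+)
    done
  then show "tsum a + tsum b + W + Z \<le> 3 + tsum k"
    and "19 * tsum a + 19 * tsum b + tsum t + 18 * W + 18 * Z \<le> 57 + 20 * tsum k" by auto
qed

text \<open>The two ends are combined with weights \<open>1 - 6 * \<epsilon>\<close> and
  \<open>6 * \<epsilon>\<close>; the latter shows up as \<open>\<epsilon> / 3\<close> because the
  second end is scaled by 18. The application takes \<open>\<epsilon> = 1 / m\<close>, so the limit
  \<open>1/6\<close> corresponds to \<open>m \<ge> 6\<close>.\<close>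

lemma config_bound:
  fixes a b t c e k u v p q g h :: "nat \<Rightarrow> real" and \<epsilon> :: real
  assumes "0 \<le> \<epsilon>" "\<epsilon> \<le> 1/6"
    and "\<And>i. a i = 0 \<or> a i = 1" "\<And>i. b i = 0 \<or> b i = 1"
    and "\<And>i. 0 \<le> t i \<and> t i \<le> 1" "\<And>i. 0 \<le> c i \<and> c i \<le> 1"
    and "\<And>i. 0 \<le> e i" "\<And>i. 0 \<le> k i" "\<And>i. 0 \<le> p i" "\<And>i. 0 \<le> q i"
      "\<And>i. 0 \<le> u i" "\<And>i. 0 \<le> v i" "\<And>i. 0 \<le> g i" "\<And>i. 0 \<le> h i"
    and "tri (\<lambda>i j l. a i + b j \<le> 1 + k l)"
    and "tri (\<lambda>i j l. a i + t j \<le> 1 + v l)" "tri (\<lambda>i j l. b i + t j \<le> 1 + u l)"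
    and "tri (\<lambda>i j l. a i + c j \<le> 1 + q l)" "tri (\<lambda>i j l. b i + c j \<le> 1 + p l)"
    and "tri (\<lambda>i j l. e i + a j \<le> 1 + g l)" "tri (\<lambda>i j l. e i + b j \<le> 1 + h l)"
    and "tri (\<lambda>i j l. e i \<le> q j + u l)" "tri (\<lambda>i j l. e i \<le> p j + v l)"
  shows "(1 + \<epsilon> / 3) * (tsum a + tsum b) + \<epsilon> / 3 * tsum t + tsum c + tsum e
    \<le> 3 + \<epsilon> + (1 + 2 * \<epsilon> / 3) * tsum k + (tsum u + tsum v) / 2
      + 9/8 * (tsum p + tsum q) + tsum g + tsum h" (is "?L \<le> ?R")
proof -
  let ?W = "tsum c / 2 + tsum e / 2 - 9/8 * tsum q - tsum u / 2 - tsum g"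
  let ?Z = "tsum c / 2 + tsum e / 2 - 9/8 * tsum p - tsum v / 2 - tsum h"
  define X where "X = tsum a + tsum b + ?W + ?Z - (3 + tsum k)"
  define Y where "Y = 19 * tsum a + 19 * tsum b + tsum t + 18 * ?W + 18 * ?Z - (57 + 20 * tsum k)"
  have X: "X \<le> 0" unfolding X_def
    using config_bound_ends(1)[of a b t c e k p q u v g h] assms(3-) by simp
  have Y: "Y \<le> 0" unfolding Y_def
    using config_bound_ends(2)[of a b t c e k p q u v g h] assms(3-) by simp
  have "?L - ?R = (1 - 6 * \<epsilon>) * X + \<epsilon> / 3 * Y"
    unfolding X_def Y_def by (simp add: field_simps)
  also have "\<dots> \<le> 0"
    using X Y assms(1,2) by (intro add_nonpos_nonpos mult_nonneg_nonpos) auto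
  finally show ?thesis by simp
qed

subsection \<open>Layer densities\<close>

locale cross_free_triple =
  fixes U :: "'a set" and F :: "nat \<Rightarrow> 'a set set"
  assumes finite_U: "finite U"
    and subset_Pow: "i \<in> {1, 2, 3} \<Longrightarrow> F i \<subseteq> Pow U"
    and cross_free: "cross_partition_free (F 1) (F 2) (F 3)"
begin

abbreviation I :: "nat \<Rightarrow> 'a set \<Rightarrow> real" where
  "I i S \<equiv> of_bool (S \<in> F i)"

definition J :: "'a set \<Rightarrow> real" where
  "J S = tsum (\<lambda>i. I i S)"

definition D :: "nat \<Rightarrow> real" where
  "D k = tsum (\<lambda>i. layer_density U (F i) k)"

definition gap :: "nat \<Rightarrow> real" where
  "gap k = 3 - D k"

lemma not_all_three:
  assumes "S \<inter> T = {}"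
  shows "tri (\<lambda>i j l. \<not> (S \<in> F i \<and> T \<in> F j \<and> S \<union> T \<in> F l))"
proof -
  have *: "\<not> (A \<in> F 1 \<and> B \<in> F 2 \<and> C \<in> F 3 \<and>
      (is_disjoint_union A B C \<or> is_disjoint_union B A C \<or> is_disjoint_union C A B))" for A B C
    using cross_free unfolding cross_partition_free_def by blast
  show ?thesis
    using *[of S T "S \<union> T"] *[of T S "S \<union> T"] *[of S "S \<union> T" T] *[of T "S \<union> T" S]
      *[of "S \<union> T" S T] *[of "S \<union> T" T S] assms
    unfolding tri_def is_disjoint_union_def by (auto simp: Un_commute Int_commute)
qed

text \<open>All three forms say that at most two of the three memberships hold. Missing memberships
  are moved to the right so that the forms match the hypotheses of
  \<open>config_bound\<close>.\<close>

lemma tri_le: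
  assumes "S \<inter> T = {}"
  shows "tri (\<lambda>i j l. I i S + I j T \<le> 1 + (1 - I l (S \<union> T)))"
    and "tri (\<lambda>i j l. I i S + I j (S \<union> T) \<le> 1 + (1 - I l T))"
    and "tri (\<lambda>i j l. I i S \<le> (1 - I j T) + (1 - I l (S \<union> T)))"
  using not_all_three[OF assms] unfolding tri_def by (auto simp: of_bool_def)

lemma sum_permutes_J:
  assumes "X \<subseteq> U"
  shows "(\<Sum>\<pi> | \<pi> permutes U. J (\<pi> ` X)) = fact (card U) * D (card X)"
  using sum_permutes_layer_density[OF finite_U assms subset_Pow]
  by (simp add: J_def sum.distrib D_def distrib_left)

lemma D_nonneg: "0 \<le> D k"
  by (simp add: D_def layer_density_def)

lemma D_le_3:
  assumes "k \<le> card U"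
  shows "D k \<le> 3"
proof -
  have "layer_density U (F i) k \<le> 1" if "i \<in> {1,2,3}" for i
  proof -
    have "card {A \<in> F i. card A = k} \<le> card {A. A \<subseteq> U \<and> card A = k}"
      using subset_Pow[OF that] finite_U by (intro card_mono) auto
    then show ?thesis using n_subsets[OF finite_U, of k] assms
      by (simp add: layer_density_def)
  qed
  from this[of 1] this[of 2] this[of 3] show ?thesis by (simp add: D_def)
qed

lemma gap_nonneg: "k \<le> card U \<Longrightarrow> 0 \<le> gap k"
  using D_le_3 by (simp add: gap_def)

text \<open>For disjoint \<open>S\<close> and \<open>T\<close>, the six orderings of the pattern
  allow at most two memberships each and count every membership of \<open>S\<close>,
  \<open>T\<close>, \<open>S \<union> T\<close> twice, which leaves at most 6. Averaging turns
  memberships into densities.\<close>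

lemma three_layers:
  assumes "a + b \<le> card U"
  shows "D a + D b + D (a + b) \<le> 6"
proof -
  obtain V where V: "V \<subseteq> U" "card V = a + b" "finite V"
    using assms by (metis obtain_subset_with_card_n)
  then obtain S where S: "S \<subseteq> V" "card S = a" "finite S"
    by (metis le_add1 obtain_subset_with_card_n)
  define T where "T = V - S"
  have T: "T \<subseteq> U" "card T = b" "S \<union> T = V" "S \<inter> T = {}" "S \<subseteq> U"
    using V S by (auto simp: T_def card_Diff_subset)
  have "J (\<pi> ` S) + J (\<pi> ` T) + J (\<pi> ` V) \<le> 6" if "\<pi> permutes U" for \<pi>
  proof -
    have "\<pi> ` S \<inter> \<pi> ` T = {}" using T(4) permutes_inj[OF that] by (simp add: image_Int[symmetric])
    from tri_le(1)[OF this] show ?thesis unfolding tri_def T(3)[symmetric] image_Un J_def by linarith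
  qed
  then have "(\<Sum>\<pi> | \<pi> permutes U. J (\<pi> ` S) + J (\<pi> ` T) + J (\<pi> ` V)) \<le> (\<Sum>\<pi> | \<pi> permutes U. 6)"
    by (intro sum_mono) auto
  also have "\<dots> = fact (card U) * 6"
    using card_permutations[OF refl finite_U] by simp
  finally have "fact (card U) * (D a + D b + D (a + b)) \<le> fact (card U) * 6"
    using sum_permutes_J[OF \<open>S \<subseteq> U\<close>] sum_permutes_J[OF T(1)] sum_permutes_J[OF V(1)] S(2) T(2) V(2)
    by (simp only: sum.distrib distrib_left)
  then show ?thesis by simp
qed

section \<open>The local inequality averaged over all partitions\<close>

text \<open>The third \<open>m\<close>-set is \<open>E \<union> {x}\<close>. Detaching
  \<open>x\<close> and attaching it elsewhere reaches the layers \<open>m - 1\<close>,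
  \<open>m + 1\<close>, \<open>2m - 1\<close> and \<open>2m + 1\<close>.\<close>

definition config :: "nat \<Rightarrow> 'a set \<Rightarrow> 'a set \<Rightarrow> 'a set \<Rightarrow> 'a \<Rightarrow> bool" where
  "config m P Q E x \<longleftrightarrow> P \<union> Q \<union> E \<union> {x} \<subseteq> U \<and> card P = m \<and> card Q = m \<and> card E = m - 1
     \<and> P \<inter> Q = {} \<and> P \<inter> E = {} \<and> Q \<inter> E = {} \<and> x \<notin> P \<and> x \<notin> Q \<and> x \<notin> E"

text \<open>With \<open>P\<close>, \<open>Q\<close> and \<open>E \<union> {x}\<close> weighted like this, the value \<open>0\<close> is attained both when one family contains
  all \<open>m\<close>-sets of the partition and when all three families contain the same one of them; equal weights
  would make the latter positive.\<close>

definition excess :: "nat \<Rightarrow> 'a set \<Rightarrow> 'a set \<Rightarrow> 'a set \<Rightarrow> 'a \<Rightarrow> real" where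
  "excess m P Q E x = (1 + 1 / m / 3) * (J P + J Q) + 1 / m / 3 * J (insert x E)
     + J (insert x (P \<union> Q)) + J E - (3 + 1 / m)
     - (1 + 2 / m / 3) * (3 - J (P \<union> Q)) - ((3 - J (insert x (E \<union> Q))) + (3 - J (insert x (E \<union> P)))) / 2
     - 9/8 * ((3 - J (insert x P)) + (3 - J (insert x Q))) - (3 - J (E \<union> P)) - (3 - J (E \<union> Q))"

lemma excess_nonpos:
  assumes "config m P Q E x" "m \<ge> 6"
  shows "excess m P Q E x \<le> 0"
proof -
  have d: "P \<inter> Q = {}" "P \<inter> E = {}" "E \<inter> P = {}" "Q \<inter> E = {}" "E \<inter> Q = {}" "x \<notin> P" "x \<notin> Q" "x \<notin> E"
    using assms(1) by (auto simp: config_def)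
  have eps: "0 \<le> 1 / real m" "1 / real m \<le> 1/6" using assms(2) by auto
  have "P \<inter> insert x E = {}" "Q \<inter> insert x E = {}" "P \<inter> insert x Q = {}" "Q \<inter> insert x P = {}"
    "E \<inter> insert x P = {}" "E \<inter> insert x Q = {}" using d by auto
  note t = tri_le[OF d(1)] tri_le[OF d(3)] tri_le[OF d(5)] tri_le[OF this(1)] tri_le[OF this(2)]
    tri_le[OF this(3)] tri_le[OF this(4)] tri_le[OF this(5)] tri_le[OF this(6)]
  have s: "P \<union> insert x E = insert x (E \<union> P)" "Q \<union> insert x E = insert x (E \<union> Q)"
    "P \<union> insert x Q = insert x (P \<union> Q)" "Q \<union> insert x P = insert x (P \<union> Q)"
    "E \<union> insert x P = insert x (E \<union> P)" "E \<union> insert x Q = insert x (E \<union> Q)" by auto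
  have main: "(1 + 1 / m / 3) * (J P + J Q) + 1 / m / 3 * J (insert x E)
     + J (insert x (P \<union> Q)) + J E \<le> 3 + 1 / m
     + (1 + 2 * (1 / m) / 3) * tsum (\<lambda>i. 1 - I i (P \<union> Q))
     + (tsum (\<lambda>i. 1 - I i (insert x (E \<union> Q))) + tsum (\<lambda>i. 1 - I i (insert x (E \<union> P)))) / 2
     + 9/8 * (tsum (\<lambda>i. 1 - I i (insert x P)) + tsum (\<lambda>i. 1 - I i (insert x Q)))
     + tsum (\<lambda>i. 1 - I i (E \<union> P)) + tsum (\<lambda>i. 1 - I i (E \<union> Q))"
    unfolding J_def
    by (rule config_bound[where a = "\<lambda>i. I i P" and b = "\<lambda>i. I i Q" and t = "\<lambda>i. I i (insert x E)"
          and c = "\<lambda>i. I i (insert x (P \<union> Q))" and e = "\<lambda>i. I i E" and k = "\<lambda>i. 1 - I i (P \<union> Q)"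
          and u = "\<lambda>i. 1 - I i (insert x (E \<union> Q))" and v = "\<lambda>i. 1 - I i (insert x (E \<union> P))"
          and p = "\<lambda>i. 1 - I i (insert x P)" and q = "\<lambda>i. 1 - I i (insert x Q)"
          and g = "\<lambda>i. 1 - I i (E \<union> P)" and h = "\<lambda>i. 1 - I i (E \<union> Q)"];
        (rule t[unfolded s] | use eps in simp))
  have eq: "tsum (\<lambda>i. 1 - I i S) = 3 - J S" for S by (simp add: J_def)
  show ?thesis using main unfolding eq excess_def times_divide_eq_right mult_1_right by linarith
qed

lemma config_image:
  assumes "config m P Q E x" "\<pi> permutes U"
  shows "config m (\<pi> ` P) (\<pi> ` Q) (\<pi> ` E) (\<pi> x)"
proof -
  have i: "inj \<pi>" using assms(2) by (rule permutes_inj)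
  have c: "card (\<pi> ` S) = card S" for S using inj_on_subset[OF i] by (auto intro: card_image)
  have d: "\<pi> ` S \<inter> \<pi> ` T = {}" if "S \<inter> T = {}" for S T using that i by (simp add: image_Int[symmetric])
  have "\<pi> ` S \<subseteq> U" if "S \<subseteq> U" for S using that permutes_in_image[OF assms(2)] by blast
  then show ?thesis using assms(1) permutes_in_image[OF assms(2)]
    by (auto simp: config_def c d inj_image_mem_iff[OF i])
qed

text \<open>This is the average of \<open>excess\<close> over all permutations. The three
  \<open>m\<close>-sets contribute \<open>2 * (1 + 1/(3m)) + 1/(3m) = 2 + 1/m\<close>, the ratio of
  \<open>3m choose m\<close> to \<open>3m choose (m - 1)\<close>; for a ground set of size
  \<open>3m\<close> the weights of \<open>D (m - 1)\<close>, \<open>D m\<close>,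
  \<open>D (2 * m + 1)\<close> are thus proportional to the sizes of these layers.\<close>

definition mean_excess :: "nat \<Rightarrow> real" where
  "mean_excess m = (2 + 1 / m) * D m + D (2 * m + 1) + D (m - 1) - (3 + 1 / m)
     - (2 + 2 / m / 3) * gap (2 * m) - 9/4 * gap (m + 1) - 2 * gap (2 * m - 1)"

lemma sum_permutes_excess:
  assumes "config m P Q E x" "m \<ge> 6"
  shows "(\<Sum>\<pi> | \<pi> permutes U. excess m (\<pi> ` P) (\<pi> ` Q) (\<pi> ` E) (\<pi> x)) = fact (card U) * mean_excess m"
proof -
  have s: "P \<subseteq> U" "Q \<subseteq> U" "insert x E \<subseteq> U" "insert x (P \<union> Q) \<subseteq> U" "E \<subseteq> U" "P \<union> Q \<subseteq> U" "insert x (E \<union> Q) \<subseteq> U"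
    "insert x (E \<union> P) \<subseteq> U" "insert x P \<subseteq> U" "insert x Q \<subseteq> U" "E \<union> P \<subseteq> U" "E \<union> Q \<subseteq> U"
    using assms(1) by (auto simp: config_def)
  have fin: "finite P" "finite Q" "finite E" using s finite_subset[OF _ finite_U] by simp_all
  have c: "card P = m" "card Q = m" "card (insert x E) = m" "card (insert x (P \<union> Q)) = 2 * m + 1" "card E = m - 1"
    "card (P \<union> Q) = 2 * m" "card (insert x (E \<union> Q)) = 2 * m" "card (insert x (E \<union> P)) = 2 * m"
    "card (insert x P) = m + 1" "card (insert x Q) = m + 1" "card (E \<union> P) = 2 * m - 1" "card (E \<union> Q) = 2 * m - 1"
  proof -
    have "card (S \<union> T) = card S + card T" if "S \<inter> T = {}" "S \<in> {P, Q, E}" "T \<in> {P, Q, E}" for S T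
      using that fin by (intro card_Un_disjoint) auto
    moreover have "P \<inter> Q = {}" "E \<inter> P = {}" "E \<inter> Q = {}" using assms(1) by (auto simp: config_def)
    ultimately show "card P = m" "card Q = m" "card (insert x E) = m" "card (insert x (P \<union> Q)) = 2 * m + 1" "card E = m - 1"
      "card (P \<union> Q) = 2 * m" "card (insert x (E \<union> Q)) = 2 * m" "card (insert x (E \<union> P)) = 2 * m"
      "card (insert x P) = m + 1" "card (insert x Q) = m + 1" "card (E \<union> P) = 2 * m - 1" "card (E \<union> Q) = 2 * m - 1"
      using assms fin by (simp_all add: config_def)
  qed
  note sJ = sum_permutes_J[OF s(1)] sum_permutes_J[OF s(2)] sum_permutes_J[OF s(3)] sum_permutes_J[OF s(4)]
    sum_permutes_J[OF s(5)] sum_permutes_J[OF s(6)] sum_permutes_J[OF s(7)] sum_permutes_J[OF s(8)]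
    sum_permutes_J[OF s(9)] sum_permutes_J[OF s(10)] sum_permutes_J[OF s(11)] sum_permutes_J[OF s(12)]
  have lin: "excess m P Q E x = (1 + 1 / m / 3) * J P + (1 + 1 / m / 3) * J Q + 1 / m / 3 * J (insert x E)
      + J (insert x (P \<union> Q)) + J E + (1 + 2 / m / 3) * J (P \<union> Q)
      + 1/2 * J (insert x (E \<union> Q)) + 1/2 * J (insert x (E \<union> P)) + 9/8 * J (insert x P)
      + 9/8 * J (insert x Q) + J (E \<union> P) + J (E \<union> Q) + - (87/4 + 3 / m)" for P Q E x
    by (simp add: excess_def algebra_simps add_divide_distrib diff_divide_distrib)
  have one: "(\<Sum>\<pi> | \<pi> permutes U. r) = fact (card U) * r" for r :: real
    using card_permutations[OF refl finite_U] by simp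
  show ?thesis
    apply (simp only: lin image_insert[symmetric] image_Un[symmetric])
    apply (simp only: sum.distrib)
    apply (simp only: sum_distrib_left[symmetric] )
    apply (simp only: sJ one c)
    by (simp add: mean_excess_def gap_def algebra_simps diff_divide_distrib)
qed

text \<open>An average of nonpositive numbers is nonpositive. If it vanishes, so does every term, in
  particular the one of the identity permutation, which is the given configuration.\<close>

lemma mean_excess_nonpos:
  assumes "config m P Q E x" "m \<ge> 6"
  shows "mean_excess m \<le> 0" and "mean_excess m = 0 \<Longrightarrow> excess m P Q E x = 0"
proof -
  let ?f = "\<lambda>\<pi>. excess m (\<pi> ` P) (\<pi> ` Q) (\<pi> ` E) (\<pi> x)"
  have le: "?f \<pi> \<le> 0" if "\<pi> permutes U" for \<pi>
    using excess_nonpos[OF config_image[OF assms(1) that] assms(2)] .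
  have "(\<Sum>\<pi> | \<pi> permutes U. ?f \<pi>) \<le> 0" using le by (intro sum_nonpos) auto
  then show "mean_excess m \<le> 0"
    unfolding sum_permutes_excess[OF assms] using fact_gt_zero[of "card U", where 'a = real] by (simp add: mult_le_0_iff)
  assume "mean_excess m = 0"
  then have "(\<Sum>\<pi> | \<pi> permutes U. - ?f \<pi>) = 0"
    using sum_permutes_excess[OF assms] by (simp add: sum_negf)
  then have "\<forall>\<pi>\<in>{\<pi>. \<pi> permutes U}. - ?f \<pi> = 0"
    using le finite_permutations[OF finite_U] by (subst (asm) sum_nonneg_eq_0_iff) auto
  from bspec[OF this, of id] show "excess m P Q E x = 0" by simp
qed

lemma sum_card_eq:
  "real (card (F 1)) + real (card (F 2)) + real (card (F 3)) = (\<Sum>k\<le>card U. real (card U choose k) * D k)"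
proof -
  have "real (card (F i)) = (\<Sum>k\<le>card U. real (card U choose k) * layer_density U (F i) k)" if "i \<in> {1,2,3}" for i
  proof -
    have fin: "finite (F i)" using subset_Pow[OF that] finite_U by (meson finite_Pow_iff finite_subset)
    have "F i = (\<Union>k\<in>{..card U}. {A \<in> F i. card A = k})"
      using subset_Pow[OF that] card_mono[OF finite_U] by auto
    then have "card (F i) = card (\<Union>k\<in>{..card U}. {A \<in> F i. card A = k})" by simp
    also have "\<dots> = (\<Sum>k\<le>card U. card {A \<in> F i. card A = k})"
      by (rule card_UN_disjoint) (use fin in auto)
    also have "real \<dots> = (\<Sum>k\<le>card U. real (card U choose k) * layer_density U (F i) k)"
      unfolding of_nat_sum by (rule sum.cong) (auto simp: layer_density_def)
    finally show ?thesis .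
  qed
  from this[of 1] this[of 2] this[of 3] show ?thesis
    by (simp add: D_def distrib_left sum.distrib)
qed

end

subsection \<open>Summation over the layers\<close>

lemma binomial_step:
  assumes "k < n"
  shows "real (Suc k) * real (n choose Suc k) = (real n - real k) * real (n choose k)"
proof -
  have "Suc k * (n choose Suc k) = (n - k) * (n choose k)"
    by (simp only: binomial_absorption binomial_absorb_comp)
  then have "real (Suc k * (n choose Suc k)) = real ((n - k) * (n choose k))" by (rule arg_cong)
  then show ?thesis using assms by (simp add: of_nat_diff algebra_simps)
qed

text \<open>The quotient of the two coefficients is \<open>(n - k + 1) / k\<close>, which is at
  least 2 precisely when \<open>3 * k \<le> n + 1\<close>.\<close>

lemma binomial_double:
  assumes "3 * k \<le> n + 1" "k \<ge> 1"
  shows "2 * (n choose (k - 1)) \<le> n choose k"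
proof -
  have "k * (n choose k) = (n - (k - 1)) * (n choose (k - 1))"
    using binomial_absorb_comp[of n "k - 1"] binomial_absorption[of "k-1" n] assms by simp
  moreover have "(2 * k) * (n choose (k - 1)) \<le> (n - (k - 1)) * (n choose (k - 1))"
    by (rule mult_le_mono1) (use assms in simp)
  ultimately have "k * (2 * (n choose (k - 1))) \<le> k * (n choose k)" by (simp only: ac_simps)
  then show ?thesis using assms(2) by simp
qed

text \<open>As for powers of two: the coefficients at least double at each step, so each one
  dominates the sum of its predecessors.\<close>

lemma binomial_sum_less_le:
  assumes "3 * k \<le> n + 1"
  shows "(\<Sum>s<k. n choose s) \<le> n choose k"
  using assms
proof (induction k)
  case (Suc k)
  then show ?case using binomial_double[of "Suc k" n] by simp
qed simp

context
  fixes m :: nat and c :: "nat \<Rightarrow> real"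
  assumes m: "m \<ge> 6"
  defines "c \<equiv> \<lambda>k. real (3 * m choose k)"
begin

lemma c_sym: "k \<le> 3 * m \<Longrightarrow> c (3 * m - k) = c k"
  by (simp add: c_def binomial_symmetric[symmetric])

lemma c_mono: "k \<le> l \<Longrightarrow> 2 * l \<le> 3 * m \<Longrightarrow> c k \<le> c l"
  by (simp add: c_def binomial_mono)

lemma c_m: "c m = (2 + 1 / m) * c (m - 1)"
  using binomial_step[of "m - 1" "3 * m"] m by (simp add: c_def field_simps of_nat_diff)

lemma c_Suc_m: "c (m + 1) = (4 - 2 / (m + 1)) * c (m - 1)"
proof -
  have "real (m + 1) * c (m + 1) = 2 * m * c m"
    using binomial_step[of m "3 * m"] m by (simp add: c_def)
  also have "\<dots> = 2 * (2 * m + 1) * c (m - 1)"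
    unfolding c_m using m by (simp add: field_simps)
  finally show ?thesis by (simp add: field_simps)
qed

lemma c_m2: "c (m - 2) = (1/2 - 1 / (m + 1)) * c (m - 1)"
proof -
  have "Suc (m - 2) = m - 1" using m by simp
  then have "(real m - 1) * c (m - 1) = (2 * m + 2) * c (m - 2)"
    using binomial_step[of "m - 2" "3 * m"] m by (simp add: c_def of_nat_diff)
  then show ?thesis by (simp add: field_simps)
qed

lemma c_double:
  assumes "k < m"
  shows "2 * c k \<le> c (k + 1)"
proof -
  have "2 * (3 * m choose k) \<le> 3 * m choose (k + 1)"
    using binomial_double[of "k + 1" "3 * m"] assms by simp
  then have "real (2 * (3 * m choose k)) \<le> real (3 * m choose (k + 1))" by (rule of_nat_mono)
  then show ?thesis by (simp add: c_def)
qed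

lemma c_pos: "k \<le> 3 * m \<Longrightarrow> 0 < c k"
  by (simp add: c_def)

lemma c_sum: "k \<le> m \<Longrightarrow> (\<Sum>s<k. c s) \<le> c k"
  using binomial_sum_less_le[of k "3 * m"] unfolding c_def by (simp flip: of_nat_sum)

text \<open>The layers \<open>m + 1\<close> and \<open>2m - 1\<close> are complementary, so by
  unimodality nothing between them is smaller.\<close>

lemma c_middle: "m + 1 \<le> b \<Longrightarrow> b \<le> 2 * m - 1 \<Longrightarrow> c (m + 1) \<le> c b"
  using c_mono[of "m + 1" b] c_mono[of "m + 1" "3 * m - b"] c_sym[of b] m by (cases "2 * b \<le> 3 * m") auto


text \<open>A layer \<open>s \<le> m - 2\<close> is charged to the gaps in the layers \<open>2m - 1 - s\<close> and \<open>2m - 1\<close>, the layer \<open>2m + 2\<close> twice to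
  \<open>m + 1\<close>, and a layer \<open>s \<ge> 2m + 3\<close> to \<open>s - m - 2\<close> and \<open>m + 2\<close>. This leaves every middle layer some
  unused capacity, hence the last summand.\<close>

lemma weighted_sum_le:
  fixes D gap :: "nat \<Rightarrow> real" and \<rho> :: real
  assumes gap: "\<And>k. gap k = 3 - D k"
    and gap_nonneg: "\<And>k. k \<le> 3 * m \<Longrightarrow> 0 \<le> gap k"
    and three: "\<And>a b. a + b \<le> 3 * m \<Longrightarrow> D a + D b + D (a + b) \<le> 6"
  defines "\<rho> \<equiv> (2 + 1 / m) * D m + D (2 * m + 1) + D (m - 1) - (3 + 1 / m)
     - (2 + 2 / m / 3) * gap (2 * m) - 9/4 * gap (m + 1) - 2 * gap (2 * m - 1)"
  shows "(\<Sum>k\<le>3*m. c k * D k) \<le> 3 * (\<Sum>k=m+1..2*m+1. c k) + c (2 * m + 1) / m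
    + c (2 * m + 1) * \<rho> - c (2 * m + 1) / (3 * m) * (\<Sum>k=m+1..2*m. gap k)"
proof -
  \<comment> \<open>\<open>C\<close> is the common size of the layers \<open>m - 1\<close> and
    \<open>2m + 1\<close>; charges and capacities are measured in it.\<close>
  define C where "C = c (m - 1)"
  have Cpos: "C > 0" unfolding C_def by (rule c_pos) simp
  have cC: "c m = (2 + 1 / m) * C" "c (2 * m) = (2 + 1 / m) * C" "c (2 * m + 1) = C"
    "c (m + 1) = (4 - 2 / (m + 1)) * C" "c (m - 2) = (1/2 - 1 / (m + 1)) * C" "c (2 * m + 2) = c (m - 2)"
    using c_m c_Suc_m c_m2 c_sym[of "2 * m"] c_sym[of "2 * m + 1"] c_sym[of "2 * m + 2"] m
    unfolding C_def by (simp_all add: Suc_diff_le numeral_2_eq_2)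
  have "m - 3 + 1 = m - 2" using m by simp
  then have c3: "c (m - 3) \<le> c (m - 2) / 2" using c_double[of "m - 3"] m by simp
  have pos: "0 \<le> c k" for k by (simp add: c_def)
  have quart: "c k \<le> C / 4" if "k \<le> m - 3" for k
  proof -
    have "c k \<le> c (m - 3)" using that m by (intro c_mono) auto
    also have "\<dots> \<le> c (m - 2) / 2" by (rule c3)
    also have "\<dots> \<le> C / 4" unfolding cC(5) using Cpos by (simp add: field_simps)
    finally show ?thesis .
  qed
  let ?M = "{m+2..2*m-1}"
  have small: "(\<Sum>s<m-1. c s * D s) \<le> c (m - 2) * gap (m + 1) + (\<Sum>b\<in>?M. C / 4 * gap b) + C * gap (2 * m - 1)"
  proof -
    have "(\<Sum>s<m-1. c s * D s) \<le> (\<Sum>s<m-1. c s * gap (2 * m - 1 - s) + c s * gap (2 * m - 1))"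
    proof (rule sum_mono)
      fix s assume "s \<in> {..<m-1}"
      then have "D s + D (2 * m - 1 - s) + D (2 * m - 1) \<le> 6"
        using three[of s "2 * m - 1 - s"] by simp
      then have "D s \<le> gap (2 * m - 1 - s) + gap (2 * m - 1)" by (simp add: gap)
      then show "c s * D s \<le> c s * gap (2 * m - 1 - s) + c s * gap (2 * m - 1)"
        using mult_left_mono[OF _ pos[of s]] by (simp add: distrib_left[symmetric])
    qed
    also have "\<dots> = (\<Sum>s<m-1. c s * gap (2 * m - 1 - s)) + (\<Sum>s<m-1. c s) * gap (2 * m - 1)"
      by (simp add: sum.distrib sum_distrib_right)
    also have "(\<Sum>s<m-1. c s * gap (2 * m - 1 - s)) = (\<Sum>b=m+1..2*m-1. c (2 * m - 1 - b) * gap b)"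
      by (rule sum.reindex_bij_witness[of _ "\<lambda>b. 2 * m - 1 - b" "\<lambda>s. 2 * m - 1 - s"]) (use m in auto)
    \<comment> \<open>The gap at \<open>m + 1\<close> is split off because it is charged by the
      layer \<open>m - 2\<close>, whose size exceeds \<open>C / 4\<close>.\<close>
    also have "\<dots> = c (m - 2) * gap (m + 1) + (\<Sum>b\<in>?M. c (2 * m - 1 - b) * gap b)"
      using m by (subst sum.atLeast_Suc_atMost) (auto simp: numeral_2_eq_2)
    also have "(\<Sum>b\<in>?M. c (2 * m - 1 - b) * gap b) \<le> (\<Sum>b\<in>?M. C / 4 * gap b)"
      by (intro sum_mono mult_right_mono quart gap_nonneg) auto
    also have "(\<Sum>s<m-1. c s) * gap (2 * m - 1) \<le> C * gap (2 * m - 1)"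
      using c_sum[of "m - 1"] by (intro mult_right_mono gap_nonneg) (auto simp: C_def)
    finally show ?thesis by simp
  qed
  have large: "(\<Sum>s=2*m+3..3*m. c s * D s) \<le> c (m - 3) * gap (m + 1) + (\<Sum>b\<in>?M. C / 4 * gap b) + C / 2 * gap (m + 2)"
  proof -
    have "(\<Sum>s=2*m+3..3*m. c s * D s) \<le> (\<Sum>s=2*m+3..3*m. c s * gap (s - (m + 2)) + c s * gap (m + 2))"
    proof (rule sum_mono)
      fix s assume "s \<in> {2*m+3..3*m}"
      then have "m + 2 + (s - (m + 2)) = s" "s \<le> 3 * m" by auto
      then have "D (m + 2) + D (s - (m + 2)) + D s \<le> 6"
        using three[of "m + 2" "s - (m + 2)"] by (simp only:)
      then have "D s \<le> gap (s - (m + 2)) + gap (m + 2)" by (simp add: gap)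
      then show "c s * D s \<le> c s * gap (s - (m + 2)) + c s * gap (m + 2)"
        using mult_left_mono[OF _ pos[of s]] by (simp add: distrib_left[symmetric])
    qed
    also have "\<dots> = (\<Sum>s=2*m+3..3*m. c s * gap (s - (m + 2))) + (\<Sum>s=2*m+3..3*m. c s) * gap (m + 2)"
      by (simp add: sum.distrib sum_distrib_right)
    also have "(\<Sum>s=2*m+3..3*m. c s * gap (s - (m + 2))) = (\<Sum>b=m+1..2*m-2. c (2 * m - 2 - b) * gap b)"
    proof (rule sum.reindex_bij_witness[of _ "\<lambda>b. b + (m + 2)" "\<lambda>s. s - (m + 2)"])
      fix s assume "s \<in> {2*m+3..3*m}"
      then have "2 * m - 2 - (s - (m + 2)) = 3 * m - s" "s \<le> 3 * m" by auto
      then show "c (2 * m - 2 - (s - (m + 2))) * gap (s - (m + 2)) = c s * gap (s - (m + 2))"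
        using c_sym[of s] by simp
    qed (use m in auto)
    also have "\<dots> = c (m - 3) * gap (m + 1) + (\<Sum>b=m+2..2*m-2. c (2 * m - 2 - b) * gap b)"
      using m by (subst sum.atLeast_Suc_atMost) (auto simp: numeral_3_eq_3 numeral_2_eq_2)
    also have "(\<Sum>b=m+2..2*m-2. c (2 * m - 2 - b) * gap b) \<le> (\<Sum>b=m+2..2*m-2. C / 4 * gap b)"
      by (intro sum_mono mult_right_mono quart gap_nonneg) auto
    also have "\<dots> \<le> (\<Sum>b\<in>?M. C / 4 * gap b)"
      using Cpos by (intro sum_mono2 mult_nonneg_nonneg gap_nonneg) auto
    also have "(\<Sum>s=2*m+3..3*m. c s) = (\<Sum>s<m-2. c s)"
      by (rule sum.reindex_bij_witness[of _ "\<lambda>s. 3 * m - s" "\<lambda>s. 3 * m - s"]) (use m c_sym in auto)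
    also have "(\<Sum>s<m-2. c s) * gap (m + 2) \<le> C / 2 * gap (m + 2)"
    proof (intro mult_right_mono gap_nonneg)
      have "c (m - 2) \<le> C / 2" unfolding cC(5) using Cpos by (simp add: field_simps)
      then show "(\<Sum>s<m-2. c s) \<le> C / 2" using c_sum[of "m - 2"] by simp
    qed (use m in auto)
    finally show ?thesis by simp
  qed
  have next_large: "c (2 * m + 2) * D (2 * m + 2) \<le> c (m - 2) * (2 * gap (m + 1))"
  proof -
    have "m + 1 + (m + 1) = 2 * m + 2" "2 * m + 2 \<le> 3 * m" using m by auto
    then have "D (m + 1) + D (m + 1) + D (2 * m + 2) \<le> 6" using three[of "m + 1" "m + 1"] by (simp only:)
    then have "D (2 * m + 2) \<le> 2 * gap (m + 1)" by (simp add: gap)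
    then show ?thesis unfolding cC(6) by (intro mult_left_mono pos)
  qed
  have split: "(\<Sum>k\<le>3*m. c k * D k) = (\<Sum>s<m-1. c s * D s) + (C * D (m - 1) + c m * D m + C * D (2 * m + 1))
      + (\<Sum>k=m+1..2*m. c k * D k) + c (2 * m + 2) * D (2 * m + 2) + (\<Sum>s=2*m+3..3*m. c s * D s)"
  proof -
    have "{..3*m} = {..<m-1} \<union> ({m - 1, m, 2 * m + 1, 2 * m + 2} \<union> ({m+1..2*m} \<union> {2*m+3..3*m}))"
      using m by auto
    then have "(\<Sum>k\<le>3*m. c k * D k) = (\<Sum>k\<in>{..<m-1} \<union> ({m - 1, m, 2 * m + 1, 2 * m + 2} \<union> ({m+1..2*m} \<union> {2*m+3..3*m})). c k * D k)"
      by simp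
    also have "\<dots> = (\<Sum>s<m-1. c s * D s) + ((\<Sum>k\<in>{m - 1, m, 2 * m + 1, 2 * m + 2}. c k * D k)
      + ((\<Sum>k=m+1..2*m. c k * D k) + (\<Sum>s=2*m+3..3*m. c s * D s)))"
      using m by (subst sum.union_disjoint; force?)+
    also have "(\<Sum>k\<in>{m - 1, m, 2 * m + 1, 2 * m + 2}. c k * D k)
        = C * D (m - 1) + c m * D m + C * D (2 * m + 1) + c (2 * m + 2) * D (2 * m + 2)"
    proof -
      have "m - 1 \<noteq> m" "m - 1 \<noteq> 2 * m + 1" "m - 1 \<noteq> 2 * m + 2" "m \<noteq> 2 * m + 1" "m \<noteq> 2 * m + 2"
        using m by auto
      moreover have "c (m - Suc 0) = C" "c (Suc (2 * m)) = C" using cC(3) by (simp_all add: C_def)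
      ultimately show ?thesis by simp
    qed
    finally show ?thesis by simp
  qed
  \<comment> \<open>Since \<open>c m = (2 + 1 / m) * C\<close>, the three outer layers amount to
    \<open>C\<close> times the positive part of \<open>\<rho>\<close>. Its gap terms reappear with a
    plus sign and have to be paid by the middle layers.\<close>
  have centre: "C * D (m - 1) + c m * D m + C * D (2 * m + 1)
      = C * \<rho> + C * (3 + 1 / m) + C * (2 + 2 / m / 3) * gap (2 * m) + 9/4 * C * gap (m + 1) + 2 * C * gap (2 * m - 1)"
    unfolding \<rho>_def cC(1) by (simp add: algebra_simps)
  define G where "G = (\<Sum>b=m+3..2*m-2. gap b)"
  have GM: "(\<Sum>b\<in>?M. f b) = f (m + 2) + (\<Sum>b=m+3..2*m-2. f b) + f (2 * m - 1)" for f :: "nat \<Rightarrow> real"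
  proof -
    have "?M = insert (m + 2) (insert (2 * m - 1) {m+3..2*m-2})" "m + 2 \<notin> insert (2 * m - 1) {m+3..2*m-2}"
      "2 * m - 1 \<notin> {m+3..2*m-2}" using m by auto
    then show ?thesis by (simp only: sum.insert finite_insert finite_atLeastAtMost add_ac simp_thms)
  qed
  have GK: "(\<Sum>b=m+1..2*m. f b) = f (m + 1) + (\<Sum>b\<in>?M. f b) + f (2 * m)" for f :: "nat \<Rightarrow> real"
  proof -
    have "{m+1..2*m} = insert (m + 1) (insert (2 * m) ?M)" "m + 1 \<notin> insert (2 * m) ?M" "2 * m \<notin> ?M"
      using m by auto
    then show ?thesis by (simp only: sum.insert finite_insert finite_atLeastAtMost add_ac simp_thms)
  qed
  \<comment> \<open>This is what the layer \<open>2m\<close> has left after paying its gap term in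
    \<open>\<rho>\<close>: \<open>2 + 1/m = (2 + 2/(3m)) + 1/(3m)\<close>.\<close>
  let ?\<delta> = "C / (3 * m)"
  have mid: "(\<Sum>k=m+1..2*m. c k * D k) = 3 * (\<Sum>k=m+1..2*m. c k) - (\<Sum>k=m+1..2*m. c k * gap k)"
    by (simp add: gap sum_subtractf sum_distrib_left algebra_simps)
  \<comment> \<open>The constant \<open>7/2\<close> is the load of the layer \<open>2m - 1\<close>:
    \<open>C / 4\<close> from each of the two sums over \<open>?M\<close>, \<open>C\<close> from the
    layers below \<open>m - 1\<close>, and \<open>2 * C\<close> from \<open>\<rho>\<close>.\<close>
  have big: "7/2 * C + ?\<delta> \<le> c b" if "b \<in> ?M" for b
  proof -
    have "1 / (3 * m) \<le> 1/(18::real)" "2 / (real m + 1) \<le> 2/7" using m by (simp_all add: field_simps)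
    then have "7/2 + 1 / (3 * m) \<le> 4 - 2 / (real m + 1)" by simp
    then have "(7/2 + 1 / (3 * m)) * C \<le> (4 - 2 / (real m + 1)) * C" using Cpos by (intro mult_right_mono) auto
    then show ?thesis using c_middle[of b] that cC(4) by (simp add: algebra_simps)
  qed
  \<comment> \<open>The layer \<open>m + 1\<close> pays \<open>9/4 * C\<close> for
    \<open>\<rho>\<close>, \<open>c (m - 2)\<close> for the layer \<open>m - 2\<close>, twice that
    for \<open>2m + 2\<close>, and \<open>c (m - 3)\<close> for \<open>2m + 3\<close>. The leading
    terms \<open>9/4 + 7/4 = 4\<close> agree on both sides, so terms of order \<open>1/m\<close>
    decide.\<close>
  have low: "9/4 * C + 3 * c (m - 2) + c (m - 3) + ?\<delta> \<le> c (m + 1)"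
  proof -
    define z where "z = 1 / (real m + 1)"
    define y where "y = 1 / (3 * real m)"
    have z: "c (m + 1) = (4 - 2 * z) * C" "c (m - 2) = (1/2 - z) * C" "?\<delta> = y * C"
      using cC(4,5) by (simp_all add: z_def y_def)
    have "y \<le> 3/2 * z" using m by (simp add: y_def z_def field_simps)
    then have "4 - 7/2 * z + y \<le> 4 - 2 * z" by simp
    then have "(4 - 7/2 * z + y) * C \<le> (4 - 2 * z) * C"
      using Cpos by (intro mult_right_mono) auto
    then show ?thesis using c3 unfolding z by (simp add: algebra_simps diff_divide_distrib)
  qed
  have top: "C * (2 + 2 / m / 3) + ?\<delta> = c (2 * m)"
    unfolding cC(2) by (simp add: field_simps)
  have gn: "0 \<le> gap (m + 1)" "0 \<le> gap (m + 2)" "0 \<le> gap (2 * m - 1)" "0 \<le> gap (2 * m)"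
    using m by (auto intro!: gap_nonneg)
  have "(\<Sum>b=m+3..2*m-2. (C / 2 + ?\<delta>) * gap b) \<le> (\<Sum>b=m+3..2*m-2. c b * gap b)"
  proof (intro sum_mono mult_right_mono)
    fix b assume "b \<in> {m+3..2*m-2}"
    then have "7/2 * C + ?\<delta> \<le> c b" "b \<le> 3 * m" using big[of b] by auto
    then show "C / 2 + ?\<delta> \<le> c b" "0 \<le> gap b" using Cpos gap_nonneg[of b] by auto
  qed
  then have s1: "(C / 2 + ?\<delta>) * G \<le> (\<Sum>b=m+3..2*m-2. c b * gap b)"
    by (simp add: G_def sum_distrib_left)
  have s2: "(C + ?\<delta>) * gap (m + 2) \<le> c (m + 2) * gap (m + 2)"
  proof (rule mult_right_mono[OF _ gn(2)])
    have "7/2 * C + ?\<delta> \<le> c (m + 2)" using m by (intro big) auto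
    then show "C + ?\<delta> \<le> c (m + 2)" using Cpos by simp
  qed
  have s3: "(7/2 * C + ?\<delta>) * gap (2 * m - 1) \<le> c (2 * m - 1) * gap (2 * m - 1)"
    using m gn by (intro mult_right_mono big) auto
  have s4: "(9/4 * C + 3 * c (m - 2) + c (m - 3) + ?\<delta>) * gap (m + 1) \<le> c (m + 1) * gap (m + 1)"
    by (rule mult_right_mono[OF low gn(1)])
  have s5: "(C * (2 + 2 / m / 3) + ?\<delta>) * gap (2 * m) = c (2 * m) * gap (2 * m)"
    unfolding top ..
  have q: "(\<Sum>b\<in>?M. C / 4 * gap b) = C / 4 * (gap (m + 2) + G + gap (2 * m - 1))"
    unfolding sum_distrib_left[symmetric] GM G_def ..
  have "(\<Sum>k\<le>3*m. c k * D k) + ?\<delta> * (\<Sum>k=m+1..2*m. gap k)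
      \<le> C * \<rho> + C * (3 + 1 / m) + 3 * (\<Sum>k=m+1..2*m. c k)"
    using small large next_large s1 s2 s3 s4 s5
    unfolding split centre mid q GK GM G_def[symmetric] by (simp add: algebra_simps)
  moreover have "(\<Sum>k=m+1..2*m+1. c k) = (\<Sum>k=m+1..2*m. c k) + C"
    using m cC(3) by simp
  ultimately show ?thesis unfolding cC(3) by (simp add: algebra_simps)
qed

end

subsection \<open>The extremal families\<close>

text \<open>Here \<open>p\<close>, \<open>q\<close>, \<open>r\<close>, \<open>c\<close> record the
  families containing three \<open>m\<close>-sets \<open>P\<close>, \<open>Q\<close>,
  \<open>R\<close> of a partition and \<open>P \<union> Q \<union> {x}\<close> with \<open>x\<close>
  in \<open>R\<close>. If \<open>p i = 1\<close>, then \<open>q\<close>, \<open>r\<close>,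
  \<open>c\<close> vanish off \<open>i\<close>, and the value \<open>3 + \<epsilon>\<close> is
  reached only by \<open>p\<close> being 1 everywhere or by all four being 1 at \<open>i\<close>. If
  \<open>p\<close> and \<open>q\<close> vanish, \<open>r\<close> and \<open>c\<close> must be 1
  everywhere.\<close>

lemma tight_config:
  fixes p q r c :: "nat \<Rightarrow> real" and \<epsilon> :: real
  assumes eps: "0 < \<epsilon>" "\<epsilon> \<le> 1/6"
    and "\<And>i. p i = 0 \<or> p i = 1" "\<And>i. q i = 0 \<or> q i = 1" "\<And>i. r i = 0 \<or> r i = 1" "\<And>i. c i = 0 \<or> c i = 1"
    and pq: "tri (\<lambda>i j l. p i + q j \<le> 1)" and pr: "tri (\<lambda>i j l. p i + r j \<le> 1)" and qr: "tri (\<lambda>i j l. q i + r j \<le> 1)"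
    and pc: "tri (\<lambda>i j l. p i + c j \<le> 1)" and qc: "tri (\<lambda>i j l. q i + c j \<le> 1)"
    and eq: "(1 + \<epsilon> / 3) * (tsum p + tsum q) + \<epsilon> / 3 * tsum r + tsum c = 3 + \<epsilon>"
  obtains (first) "\<forall>i\<in>{1,2,3}. p i = 1" | (second) "\<forall>i\<in>{1,2,3}. q i = 1"
    | (third) "\<forall>i\<in>{1,2,3}. r i = 1 \<and> c i = 1"
    | (row) i where "i \<in> {1,2,3}" "p i = 1" "q i = 1" "r i = 1" "c i = 1"
proof -
  \<comment> \<open>The functions are generalised because the claim is used a second time with
    \<open>p\<close> and \<open>q\<close> exchanged.\<close>
  have main: "(p j = 1 \<and> p l = 1) \<or> (q i = 1 \<and> r i = 1 \<and> c i = 1)"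
    if "p i = 1" "p i + q j \<le> 1" "p i + q l \<le> 1" "p i + r j \<le> 1" "p i + r l \<le> 1" "p i + c j \<le> 1" "p i + c l \<le> 1"
      "p j + q i \<le> 1" "p l + q i \<le> 1" "p j + r i \<le> 1" "p l + r i \<le> 1" "p j + c i \<le> 1" "p l + c i \<le> 1"
      "(1 + \<epsilon> / 3) * (tsum p + tsum q) + \<epsilon> / 3 * tsum r + tsum c = 3 + \<epsilon>"
      "\<And>i. p i = 0 \<or> p i = 1" "\<And>i. q i = 0 \<or> q i = 1" "\<And>i. r i = 0 \<or> r i = 1" "\<And>i. c i = 0 \<or> c i = 1"
      "\<And>f :: nat \<Rightarrow> real. tsum f = f i + f j + f l"
    for p q r c :: "nat \<Rightarrow> real" and i j l :: nat
  proof -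
    have "q j = 0" "q l = 0" "r j = 0" "r l = 0" "c j = 0" "c l = 0"
      using that(1-7) that(16)[of j] that(16)[of l] that(17)[of j] that(17)[of l] that(18)[of j] that(18)[of l] by auto
    then have e: "(1 + \<epsilon> / 3) * (1 + p j + p l + q i) + \<epsilon> / 3 * r i + c i = 3 + \<epsilon>"
      using that(1,14) unfolding that(19) by simp
    show ?thesis
      using that(15)[of j] that(15)[of l] that(16)[of i] that(17)[of i] that(18)[of i] that(8-13) e eps
      by (elim disjE) (simp_all add: field_simps)
  qed
  show thesis
  proof (cases "tsum p + tsum q = 0")
    case True
    have pq0: "p 1 = 0" "p 2 = 0" "p 3 = 0" "q 1 = 0" "q 2 = 0" "q 3 = 0"
      using True assms(3)[of 1] assms(3)[of 2] assms(3)[of 3] assms(4)[of 1] assms(4)[of 2] assms(4)[of 3] by auto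
    have y: "\<epsilon> / 3 * r i \<le> \<epsilon> / 3" "c i \<le> 1" for i using assms(5,6)[of i] eps by auto
    have "\<epsilon> / 3 * r 1 + \<epsilon> / 3 * r 2 + \<epsilon> / 3 * r 3 + tsum c = 3 + \<epsilon>"
      using eq pq0 by (simp add: distrib_left)
    then have "\<epsilon> / 3 * r 1 = \<epsilon> / 3 \<and> \<epsilon> / 3 * r 2 = \<epsilon> / 3 \<and> \<epsilon> / 3 * r 3 = \<epsilon> / 3 \<and> c 1 = 1 \<and> c 2 = 1 \<and> c 3 = 1"
      using y[of 1] y[of 2] y[of 3] by (intro conjI; linarith)
    then show thesis using eps by (intro third) auto
  next
    case False
    then obtain i where i: "i \<in> {1,2,3}" "p i = 1 \<or> q i = 1"
      using assms(3)[of 1] assms(3)[of 2] assms(3)[of 3] assms(4)[of 1] assms(4)[of 2] assms(4)[of 3] by auto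
    then obtain j l :: nat where jl: "(i, j, l) \<in> {(1,2,3), (2,1,3), (3,1,2)}" by auto
    have sums: "tsum f = f i + f j + f l" for f :: "nat \<Rightarrow> real" using jl by auto
    have eq': "(1 + \<epsilon> / 3) * (tsum q + tsum p) + \<epsilon> / 3 * tsum r + tsum c = 3 + \<epsilon>"
      using eq by (simp only: add.commute[of "tsum q" "tsum p"])
    note all = pq pr qr pc qc
    have P: "(p j = 1 \<and> p l = 1) \<or> (q i = 1 \<and> r i = 1 \<and> c i = 1)" if "p i = 1"
      by (rule main[of p i q j l r c, OF that _ _ _ _ _ _ _ _ _ _ _ _ eq assms(3-6) sums])
        (use jl all in \<open>auto simp: tri_def\<close>)
    have Q: "(q j = 1 \<and> q l = 1) \<or> (p i = 1 \<and> r i = 1 \<and> c i = 1)" if "q i = 1"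
      by (rule main[of q i p j l r c, OF that _ _ _ _ _ _ _ _ _ _ _ _ eq' assms(4,3,5,6) sums])
        (use jl all in \<open>auto simp: tri_def add.commute\<close>)
    show thesis using i P Q first second row[of i] jl by auto
  qed
qed

section \<open>Full middle layers, empty outer layers and tight partitions\<close>

locale extremal_triple = cross_free_triple +
  fixes m :: nat
  assumes card_U: "card U = 3 * m" and m: "m \<ge> 6"
    and gap_0: "\<And>k. m + 1 \<le> k \<Longrightarrow> k \<le> 2 * m \<Longrightarrow> gap k = 0"
    and mean_excess_0: "mean_excess m = 0"
begin

lemma layer_full:
  assumes "D k = 3" "i \<in> {1, 2, 3}" "S \<subseteq> U" "card S = k"
  shows "S \<in> F i"
proof -
  have k: "k \<le> card U" using assms(3,4) finite_U card_mono by blast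
  have le: "card {A \<in> F j. card A = k} \<le> card {A. A \<subseteq> U \<and> card A = k}" if "j \<in> {1,2,3}" for j
    using subset_Pow[OF that] finite_U by (intro card_mono) auto
  then have "layer_density U (F j) k \<le> 1" if "j \<in> {1,2,3}" for j
    using n_subsets[OF finite_U, of k] k that by (simp add: layer_density_def)
  from this[of 1] this[of 2] this[of 3] have "layer_density U (F i) k = 1"
    using assms(1,2) by (auto simp: D_def)
  then have "card {A \<in> F i. card A = k} = card {A. A \<subseteq> U \<and> card A = k}"
    using n_subsets[OF finite_U, of k] k by (simp add: layer_density_def)
  then have "{A \<in> F i. card A = k} = {A. A \<subseteq> U \<and> card A = k}"
    using subset_Pow[OF assms(2)] finite_U by (intro card_subset_eq) auto
  then show ?thesis using assms(3,4) by blast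
qed

lemma layer_empty:
  assumes "D k = 0" "i \<in> {1, 2, 3}" "card S = k"
  shows "S \<notin> F i"
proof
  assume S: "S \<in> F i"
  then have SU: "S \<subseteq> U" using subset_Pow[OF assms(2)] by auto
  have k: "k \<le> card U" using SU assms(3) finite_U card_mono by blast
  have nn: "0 \<le> layer_density U (F j) k" for j by (simp add: layer_density_def)
  have "layer_density U (F i) k = 0"
    using nn[of 1] nn[of 2] nn[of 3] assms(1,2) by (auto simp: D_def)
  then have "card {A \<in> F i. card A = k} = 0" using k by (simp add: layer_density_def)
  moreover have "finite {A \<in> F i. card A = k}"
    using subset_Pow[OF assms(2)] finite_U by (auto intro: finite_subset[of _ "Pow U"])
  ultimately show False using S assms(3) by auto
qed

lemma middle:
  assumes "i \<in> {1, 2, 3}" "S \<subseteq> U" "m + 1 \<le> card S" "card S \<le> 2 * m"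
  shows "S \<in> F i"
  using layer_full[OF _ assms(1,2)] gap_0[OF assms(3,4)] by (simp add: gap_def)

text \<open>Adding \<open>m + 1\<close> to \<open>k < m\<close>, or subtracting it from
  \<open>k \<ge> 2m + 2\<close>, lands in a full middle layer. Two full layers already use up the
  bound 6 of \<open>three_layers\<close>.\<close>

lemma D_outer:
  assumes "k \<le> 3 * m" "k < m \<or> 2 * m + 2 \<le> k"
  shows "D k = 0"
proof -
  have 3: "D l = 3" if "m + 1 \<le> l" "l \<le> 2 * m" for l using gap_0[OF that] by (simp add: gap_def)
  have "D k \<le> 0"
  proof (cases "k < m")
    case True
    then have "D k + D (m + 1) + D (k + (m + 1)) \<le> 6" using m card_U by (intro three_layers) auto
    then show ?thesis using 3[of "m + 1"] 3[of "k + (m + 1)"] True m by simp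
  next
    case False
    then have k: "2 * m + 2 \<le> k" "m + 1 + (k - (m + 1)) = k" using assms(2) by auto
    have "D (m + 1) + D (k - (m + 1)) + D (m + 1 + (k - (m + 1))) \<le> 6"
      by (rule three_layers) (use k assms(1) card_U in simp)
    then show ?thesis using 3[of "m + 1"] 3[of "k - (m + 1)"] k assms(1) m by simp
  qed
  then show ?thesis using D_nonneg[of k] by simp
qed

text \<open>The union lies in a full layer, hence also in the third family, where it would complete
  a forbidden pattern.\<close>

lemma conflict:
  assumes "i \<in> {1, 2, 3}" "j \<in> {1, 2, 3}" "i \<noteq> j" "S \<inter> T = {}" "m + 1 \<le> card (S \<union> T)" "card (S \<union> T) \<le> 2 * m"
  shows "\<not> (S \<in> F i \<and> T \<in> F j)"
proof
  assume *: "S \<in> F i \<and> T \<in> F j"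
  then have "S \<union> T \<subseteq> U" using subset_Pow assms(1,2) by blast
  then have "\<And>l. l \<in> {1,2,3} \<Longrightarrow> S \<union> T \<in> F l" using middle assms(5,6) by blast
  then show False using * not_all_three[OF assms(4)] assms(1-3) by (auto simp: tri_def)
qed

lemma conflict_superset:
  assumes "i \<in> {1, 2, 3}" "j \<in> {1, 2, 3}" "i \<noteq> j" "S \<subseteq> C" "m + 1 \<le> card (C - S)" "card (C - S) \<le> 2 * m"
  shows "\<not> (S \<in> F i \<and> C \<in> F j)"
proof
  assume *: "S \<in> F i \<and> C \<in> F j"
  then have "C - S \<subseteq> U" using subset_Pow assms(2) by blast
  then have 1: "\<And>l. l \<in> {1,2,3} \<Longrightarrow> C - S \<in> F l" using middle assms(5,6) by blast
  have 2: "S \<inter> (C - S) = {}" "S \<union> (C - S) = C" using assms(4) by auto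
  show False using * 1 not_all_three[OF 2(1)] assms(1-3) unfolding tri_def 2(2) by auto
qed

definition m_sets :: "'a set set" where
  "m_sets = {S. S \<subseteq> U \<and> card S = m}"

lemma m_sets_union:
  assumes "P \<in> m_sets" "Q \<in> m_sets" "P \<inter> Q = {}"
  shows "card (P \<union> Q) = 2 * m"
  using assms finite_subset[OF _ finite_U] by (subst card_Un_disjoint) (auto simp: m_sets_def)

lemma m_sets_conflict:
  assumes "i \<in> {1, 2, 3}" "j \<in> {1, 2, 3}" "i \<noteq> j" "P \<in> m_sets" "Q \<in> m_sets" "P \<inter> Q = {}" "P \<in> F i"
  shows "Q \<notin> F j"
  using conflict[OF assms(1-3,6)] m_sets_union[OF assms(4-6)] assms(7) m by auto

lemma m_sets_conflict_superset:
  assumes "i \<in> {1, 2, 3}" "j \<in> {1, 2, 3}" "i \<noteq> j" "P \<in> m_sets" "P \<in> F i" "P \<subseteq> C" "card C = 2 * m + 1"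
  shows "C \<notin> F j"
proof -
  have "finite P" using assms(4) finite_U finite_subset by (auto simp: m_sets_def)
  then have "card (C - P) = m + 1" using assms(4,6,7) by (simp add: card_Diff_subset m_sets_def)
  then show ?thesis using conflict_superset[OF assms(1-3,6)] assms(5) m by simp
qed

lemma tight_partition:
  assumes P: "P \<in> m_sets" "Q \<in> m_sets" "P \<inter> Q = {}" and R: "R = U - P - Q" and x: "x \<in> R"
  obtains (first) "\<forall>i\<in>{1,2,3}. P \<in> F i" | (second) "\<forall>i\<in>{1,2,3}. Q \<in> F i"
    | (third) "\<forall>i\<in>{1,2,3}. R \<in> F i \<and> insert x (P \<union> Q) \<in> F i"
    | (row) i where "i \<in> {1,2,3}" "P \<in> F i" "Q \<in> F i" "R \<in> F i" "insert x (P \<union> Q) \<in> F i"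
proof -
  define E where "E = R - {x}"
  define C where "C = insert x (P \<union> Q)"
  have sub: "P \<subseteq> U" "Q \<subseteq> U" "R \<subseteq> U" using P R by (auto simp: m_sets_def)
  have fin: "finite P" "finite Q" "finite R" using sub finite_subset[OF _ finite_U] by auto
  have cPQ: "card (P \<union> Q) = 2 * m" using m_sets_union P by blast
  have "R = U - (P \<union> Q)" using R by auto
  then have cR: "card R = m" using cPQ card_U sub fin by (simp add: card_Diff_subset)
  have RL: "R \<in> m_sets" using cR sub by (simp add: m_sets_def)
  have d: "P \<inter> R = {}" "Q \<inter> R = {}" using R by auto
  have cE: "card E = m - 1" "insert x E = R" using x cR fin by (auto simp: E_def)
  have cfg: "config m P Q E x"
    using P sub cE(1) d x by (auto simp: config_def m_sets_def E_def)
  have "x \<notin> P" "x \<notin> Q" using d x by auto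
  then have cC: "card C = 2 * m + 1" using cPQ fin by (simp add: C_def)
  have full: "J S = 3" if "S \<subseteq> U" "m + 1 \<le> card S" "card S \<le> 2 * m" for S
    using middle[OF _ that] by (simp add: J_def)
  have cs: "card (insert x P) = m + 1" "card (insert x Q) = m + 1" "card (E \<union> P) = 2 * m - 1" "card (E \<union> Q) = 2 * m - 1"
    "card (insert x (E \<union> P)) = 2 * m" "card (insert x (E \<union> Q)) = 2 * m"
  proof -
    have c2: "card (E \<union> S) = 2 * m - 1" "card (insert x (E \<union> S)) = 2 * m" "card (insert x S) = m + 1"
      if "S \<inter> R = {}" "S \<in> m_sets" for S
    proof -
      have "finite S" using that finite_U finite_subset by (auto simp: m_sets_def)
      moreover have "E \<inter> S = {}" "x \<notin> S" "x \<notin> E" using that x by (auto simp: E_def)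
      moreover have "finite E" using fin by (simp add: E_def)
      ultimately show "card (E \<union> S) = 2 * m - 1" "card (insert x (E \<union> S)) = 2 * m" "card (insert x S) = m + 1"
        using that cE m by (auto simp: m_sets_def card_Un_disjoint)
    qed
    show "card (insert x P) = m + 1" "card (insert x Q) = m + 1" "card (E \<union> P) = 2 * m - 1" "card (E \<union> Q) = 2 * m - 1"
      "card (insert x (E \<union> P)) = 2 * m" "card (insert x (E \<union> Q)) = 2 * m"
      using c2 d P by auto
  qed
  have us: "insert x P \<subseteq> U" "insert x Q \<subseteq> U" "E \<union> P \<subseteq> U" "E \<union> Q \<subseteq> U" "insert x (E \<union> P) \<subseteq> U" "insert x (E \<union> Q) \<subseteq> U"
    using sub x by (auto simp: E_def)
  have J3: "J (P \<union> Q) = 3" "J (insert x P) = 3" "J (insert x Q) = 3" "J (E \<union> P) = 3" "J (E \<union> Q) = 3"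
    "J (insert x (E \<union> P)) = 3" "J (insert x (E \<union> Q)) = 3"
    using sub us cs cPQ m by (auto intro!: full)
  have "J E = 0"
    using layer_empty[of "m - 1" _ E] D_outer[of "m - 1"] cE m by (simp add: J_def)
  \<comment> \<open>All gap terms of \<open>excess\<close> vanish and \<open>E\<close> lies in no
    family, so only the three \<open>m\<close>-sets and \<open>C\<close> remain in the tight
    inequality.\<close>
  with J3 mean_excess_nonpos(2)[OF cfg m mean_excess_0]
  have eq: "(1 + 1 / m / 3) * (J P + J Q) + 1 / m / 3 * J R + J C = 3 + 1 / m"
    by (simp add: excess_def cE C_def)
  have eps: "0 < 1 / real m" "1 / real m \<le> 1/6" using m by auto
  have le: "I i S + I j T \<le> 1" if "i \<in> {1,2,3}" "j \<in> {1,2,3}" "i \<noteq> j" "S \<in> m_sets" "T \<in> m_sets" "S \<inter> T = {}" for i j S T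
    using m_sets_conflict[OF that] by (auto simp: of_bool_def)
  have leC: "I i S + I j C \<le> 1" if "i \<in> {1,2,3}" "j \<in> {1,2,3}" "i \<noteq> j" "S \<in> {P, Q}" for i j S
    using m_sets_conflict_superset[of i j S C] cC P that by (auto simp: C_def of_bool_def)
  show thesis
    by (rule tight_config[of "1 / real m" "\<lambda>i. I i P" "\<lambda>i. I i Q" "\<lambda>i. I i R" "\<lambda>i. I i C"])
      (use eps eq le leC P RL d first second third row in \<open>auto simp: tri_def J_def C_def[symmetric]\<close>)
qed


text \<open>An \<open>m\<close>-set common to all three families makes the partitions through it tight as well, but such sets
  can be exchanged element by element until two of them are disjoint.\<close>

definition common :: "'a set set" where
  "common = {S \<in> m_sets. \<forall>i\<in>{1,2,3}. S \<in> F i}"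

lemma obtain_disjoint_m_set:
  assumes "A \<subseteq> U" "card A \<le> 2 * m"
  obtains Q where "Q \<in> m_sets" "Q \<inter> A = {}"
proof -
  have "finite A" using assms(1) finite_U finite_subset by auto
  then have "m \<le> card (U - A)" using assms card_U by (simp add: card_Diff_subset)
  then obtain Q where "Q \<subseteq> U - A" "card Q = m" by (metis obtain_subset_with_card_n)
  then show thesis using that[of Q] by (auto simp: m_sets_def)
qed

lemma common_disjoint:
  assumes "P \<in> common" "Q \<in> m_sets" "P \<inter> Q = {}" "i \<in> {1,2,3}"
  shows "Q \<notin> F i"
proof -
  have "\<exists>j\<in>{1,2,3}. j \<noteq> i" by auto
  then obtain j where "j \<in> {1,2,3}" "j \<noteq> i" by blast
  then show ?thesis using m_sets_conflict[of j i P Q] assms by (auto simp: common_def)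
qed

lemma complement_m_set:
  assumes "P \<in> m_sets" "Q \<in> m_sets" "P \<inter> Q = {}"
  shows "U - P - Q \<in> m_sets"
proof -
  have "P \<subseteq> U" "Q \<subseteq> U" "finite (P \<union> Q)" using assms finite_U finite_subset by (auto simp: m_sets_def)
  then have "card (U - (P \<union> Q)) = m"
    using m_sets_union[OF assms] card_U by (simp add: card_Diff_subset)
  then show ?thesis by (auto simp: m_sets_def Diff_Diff_Int Un_Diff set_diff_eq conj_ac)
qed

lemma m_sets_nonempty: "P \<in> m_sets \<Longrightarrow> P \<noteq> {}"
  using m by (auto simp: m_sets_def)

lemma m_sets_finite: "P \<in> m_sets \<Longrightarrow> finite P"
  using finite_U finite_subset by (auto simp: m_sets_def)

text \<open>Split the complement of \<open>P\<close> into \<open>m\<close>-sets \<open>A\<close> and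
  \<open>B\<close>. Neither lies in any family, so tightness puts
  \<open>A \<union> B \<union> {x}\<close> into all three families; this set contains
  \<open>Y\<close> and conflicts with it.\<close>

lemma common_almost_disjoint:
  assumes P: "P \<in> common" and Y: "Y \<in> m_sets" "Y \<inter> P \<subseteq> {x}" "x \<in> P" and i: "i \<in> {1,2,3}"
  shows "Y \<notin> F i"
proof -
  have PL: "P \<in> m_sets" using P by (simp add: common_def)
  have PU: "P \<subseteq> U" "card P \<le> 2 * m" using PL by (auto simp: m_sets_def)
  obtain A where A: "A \<in> m_sets" "A \<inter> P = {}" using obtain_disjoint_m_set[OF PU] by blast
  define B where "B = U - P - A"
  have B: "B \<in> m_sets" "B \<inter> P = {}" "A \<inter> B = {}" unfolding B_def using complement_m_set[OF PL A(1)] A by auto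
  have R: "P = U - A - B" using PU A by (auto simp: B_def)
  define C where "C = insert x (A \<union> B)"
  have C: "\<forall>j\<in>{1,2,3}. C \<in> F j"
    by (rule tight_partition[OF A(1) B(1) B(3) R Y(3)])
      (use common_disjoint[OF P A(1)] common_disjoint[OF P B(1)] A B in \<open>auto simp: C_def\<close>)
  have cC: "card C = 2 * m + 1"
    using m_sets_union[OF A(1) B(1,3)] Y(3) A B m_sets_finite[OF A(1)] m_sets_finite[OF B(1)] by (auto simp: C_def card_insert_if)
  have YC: "Y \<subseteq> C" using Y R by (auto simp: C_def m_sets_def)
  have "\<exists>j\<in>{1,2,3}. j \<noteq> i" by auto
  then obtain j where "j \<in> {1,2,3}" "j \<noteq> i" by blast
  then show ?thesis using m_sets_conflict_superset[OF i _ _ Y(1) _ YC cC, of j] C by auto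
qed

text \<open>Complete the new set \<open>S\<close> to a partition by a \<open>Q\<close> avoiding
  \<open>P\<close> and \<open>w\<close>. The third part meets \<open>P\<close> at most in
  \<open>y\<close>, so neither it nor \<open>Q\<close> lies in any family, and tightness leaves only
  \<open>S\<close>.\<close>

lemma common_swap:
  assumes P: "P \<in> common" and y: "y \<in> P" and w: "w \<in> U" "w \<notin> P"
  shows "insert w (P - {y}) \<in> common"
proof -
  have PL: "P \<in> m_sets" using P by (simp add: common_def)
  define S where "S = insert w (P - {y})"
  have fP: "finite P" "P \<subseteq> U" using m_sets_finite[OF PL] PL by (auto simp: m_sets_def)
  have SL: "S \<in> m_sets" using PL w y fP m by (auto simp: S_def m_sets_def)
  have "card (insert w P) \<le> 2 * m" using PL w fP m by (simp add: m_sets_def)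
  then obtain Q where Q: "Q \<in> m_sets" "Q \<inter> insert w P = {}"
    using obtain_disjoint_m_set[of "insert w P"] w fP by auto
  define R where "R = U - S - Q"
  have SQ: "S \<inter> Q = {}" using Q by (auto simp: S_def)
  have RL: "R \<in> m_sets" unfolding R_def by (rule complement_m_set[OF SL Q(1) SQ])
  have RP: "R \<inter> P \<subseteq> {y}" by (auto simp: R_def S_def)
  have nR: "R \<notin> F i" if "i \<in> {1,2,3}" for i using common_almost_disjoint[OF P RL RP y that] .
  have nQ: "Q \<notin> F i" if "i \<in> {1,2,3}" for i using common_disjoint[OF P Q(1) _ that] Q(2) by auto
  obtain x where "x \<in> R" using m_sets_nonempty[OF RL] by auto
  then have "\<forall>i\<in>{1,2,3}. S \<in> F i"
    by (rule tight_partition[OF SL Q(1) SQ R_def]) (use nR nQ in auto)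
  then show ?thesis using SL by (simp add: common_def S_def)
qed

lemma common_empty: "common = {}"
proof (rule ccontr)
  assume "common \<noteq> {}"
  then obtain P0 where P0: "P0 \<in> common" by auto
  \<comment> \<open>With \<open>P\<close> overlapping \<open>P0\<close> as little as possible,
    exchanging a shared element for one outside both sets contradicts minimality.\<close>
  then obtain P where P: "P \<in> common" "\<And>S. S \<in> common \<Longrightarrow> card (P \<inter> P0) \<le> card (S \<inter> P0)"
    using ex_has_least_nat[of "\<lambda>S. S \<in> common" P0 "\<lambda>S. card (S \<inter> P0)"] by blast
  have L: "P \<in> m_sets" "P0 \<in> m_sets" using P(1) P0 by (auto simp: common_def)
  have fin: "finite P" "finite P0" using L m_sets_finite by auto
  have "card (P \<union> P0) \<le> 2 * m" using card_Un_le[of P P0] L by (simp add: m_sets_def)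
  then obtain Q where Q: "Q \<in> m_sets" "Q \<inter> (P \<union> P0) = {}"
    using obtain_disjoint_m_set[of "P \<union> P0"] L by (auto simp: m_sets_def)
  obtain w where w: "w \<in> Q" using m_sets_nonempty[OF Q(1)] by auto
  show False
  proof (cases "P \<inter> P0 = {}")
    case True
    then show False using common_disjoint[OF P(1) L(2), of 1] P0 by (auto simp: common_def)
  next
    case False
    then obtain y where y: "y \<in> P" "y \<in> P0" by auto
    have "insert w (P - {y}) \<in> common"
      using common_swap[OF P(1) y(1), of w] w Q by (auto simp: m_sets_def)
    moreover have "insert w (P - {y}) \<inter> P0 = P \<inter> P0 - {y}" using w Q by auto
    ultimately have "card (P \<inter> P0) \<le> card (P \<inter> P0 - {y})" using P(2) by metis
    moreover have "card (P \<inter> P0 - {y}) < card (P \<inter> P0)" using y fin by (intro card_Diff1_less) auto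
    ultimately show False by simp
  qed
qed

lemma row:
  assumes "P \<in> m_sets" "Q \<in> m_sets" "P \<inter> Q = {}" "x \<in> U" "x \<notin> P" "x \<notin> Q"
  obtains i where "i \<in> {1,2,3}" "P \<in> F i" "Q \<in> F i" "insert x (P \<union> Q) \<in> F i"
proof -
  have x: "x \<in> U - P - Q" using assms by auto
  have "\<not> (\<forall>i\<in>{1,2,3}. S \<in> F i)" if "S \<in> m_sets" for S
    using common_empty that by (auto simp: common_def)
  then have n: "\<not> (\<forall>i\<in>{1,2,3}. P \<in> F i)" "\<not> (\<forall>i\<in>{1,2,3}. Q \<in> F i)" "\<not> (\<forall>i\<in>{1,2,3}. U - P - Q \<in> F i)"
    using assms complement_m_set by blast+
  show thesis
    by (rule tight_partition[OF assms(1-3) refl x]) (use n that in blast)+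
qed

text \<open>Some family contains both \<open>P\<close> and a disjoint \<open>m\<close>-set
  \<open>Q\<close>. Since \<open>Q\<close> conflicts with \<open>P\<close> in any other family, that
  family is the only one containing \<open>P\<close>.\<close>

lemma m_sets_unique:
  assumes "P \<in> m_sets" "i \<in> {1,2,3}" "j \<in> {1,2,3}" "P \<in> F i" "P \<in> F j"
  shows "i = j"
proof (rule ccontr)
  assume ne: "i \<noteq> j"
  obtain Q where Q: "Q \<in> m_sets" "Q \<inter> P = {}" using obtain_disjoint_m_set[of P] assms(1) by (auto simp: m_sets_def)
  have PQ: "P \<inter> Q = {}" using Q by auto
  obtain x where "x \<in> U - P - Q" using m_sets_nonempty[OF complement_m_set[OF assms(1) Q(1) PQ]] by auto
  then obtain l where l: "l \<in> {1,2,3}" "P \<in> F l" "Q \<in> F l"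
    using row[OF assms(1) Q(1) PQ, of x] by auto
  have "l = i" using m_sets_conflict[of i l P Q] assms l Q(1) PQ by auto
  moreover have "l = j" using m_sets_conflict[of j l P Q] assms l Q(1) PQ by auto
  ultimately show False using ne by simp
qed

text \<open>Any two \<open>m\<close>-sets have a common disjoint \<open>m\<close>-set, because their
  union has at most \<open>2m\<close> elements. Its unique family contains both of them.\<close>

lemma row_constant:
  obtains i where "i \<in> {1,2,3}" "\<And>P. P \<in> m_sets \<Longrightarrow> P \<in> F i"
proof -
  have disj: "\<exists>l\<in>{1,2,3}. P \<in> F l \<and> Q \<in> F l" if PQ: "P \<in> m_sets" "Q \<in> m_sets" "P \<inter> Q = {}" for P Q
  proof -
    obtain x where "x \<in> U - P - Q" using m_sets_nonempty[OF complement_m_set[OF PQ]] by auto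
    then show ?thesis using row[OF PQ, of x] by auto
  qed
  obtain P0 where P0: "P0 \<in> m_sets" using obtain_disjoint_m_set[of "{}"] by auto
  have same: "\<exists>l\<in>{1,2,3}. P \<in> F l \<and> P0 \<in> F l" if P: "P \<in> m_sets" for P
  proof -
    have "card (P \<union> P0) \<le> 2 * m" using card_Un_le[of P P0] P P0 by (simp add: m_sets_def)
    then obtain Q where Q: "Q \<in> m_sets" "Q \<inter> (P \<union> P0) = {}"
      using obtain_disjoint_m_set[of "P \<union> P0"] P P0 by (auto simp: m_sets_def)
    then have "P \<inter> Q = {}" "P0 \<inter> Q = {}" by auto
    then obtain l l' where l: "l \<in> {1,2,3}" "P \<in> F l" "Q \<in> F l" and l': "l' \<in> {1,2,3}" "P0 \<in> F l'" "Q \<in> F l'"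
      using disj[OF P Q(1)] disj[OF P0 Q(1)] by blast
    have "l = l'" using m_sets_unique[OF Q(1) l(1) l'(1) l(3) l'(3)] .
    then show ?thesis using l l' by blast
  qed
  obtain i where i: "i \<in> {1,2,3}" "P0 \<in> F i" using same[OF P0] by blast
  have "P \<in> F i" if "P \<in> m_sets" for P
    using same[OF that] m_sets_unique[OF P0 i(1) _ i(2)] by blast
  with i show thesis using that by blast
qed

lemma extremal_structure:
  obtains i where "i \<in> {1,2,3}" "F i = {A. A \<subseteq> U \<and> m \<le> card A \<and> card A \<le> 2 * m + 1}"
    "\<And>j. j \<in> {1,2,3} \<Longrightarrow> j \<noteq> i \<Longrightarrow> F j = {A. A \<subseteq> U \<and> m + 1 \<le> card A \<and> card A \<le> 2 * m}"
proof -
  obtain i where i: "i \<in> {1,2,3}" "\<And>P. P \<in> m_sets \<Longrightarrow> P \<in> F i" using row_constant by blast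
  have range: "A \<subseteq> U \<and> m \<le> card A \<and> card A \<le> 2 * m + 1" if "A \<in> F j" "j \<in> {1,2,3}" for A j
  proof -
    have A: "A \<subseteq> U" using subset_Pow that by blast
    then have "card A \<le> 3 * m" using card_mono[OF finite_U] card_U by metis
    then show ?thesis using A D_outer[of "card A"] layer_empty[OF _ that(2) refl] that(1) by fastforce
  qed
  \<comment> \<open>Splitting \<open>C\<close> into two \<open>m\<close>-sets and a point puts
    \<open>C\<close> into the family of its \<open>m\<close>-subsets and, by conflict with such a
    subset, into no other.\<close>
  have top: "C \<in> F i \<and> (\<forall>j\<in>{1,2,3} - {i}. C \<notin> F j)" if C: "C \<subseteq> U" "card C = 2 * m + 1" for C
  proof -
    have fC: "finite C" using C finite_U finite_subset by auto
    obtain P where P: "P \<subseteq> C" "card P = m" using obtain_subset_with_card_n[of m C] C by auto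
    have fP: "finite P" using P fC finite_subset by auto
    have "card (C - P) = m + 1" using P C fP by (simp add: card_Diff_subset)
    then obtain Q where Q: "Q \<subseteq> C - P" "card Q = m" using obtain_subset_with_card_n[of m "C - P"] by auto
    have fQ: "finite Q" using Q fC finite_subset by blast
    have L: "P \<in> m_sets" "Q \<in> m_sets" "P \<inter> Q = {}" using P Q C by (auto simp: m_sets_def)
    have "card (C - (P \<union> Q)) = 1" using m_sets_union[OF L] P Q C fP fQ by (subst card_Diff_subset) auto
    then obtain x where x: "C - (P \<union> Q) = {x}" by (auto simp: card_1_singleton_iff)
    then have Cx: "C = insert x (P \<union> Q)" "x \<in> U" "x \<notin> P" "x \<notin> Q" using P Q C by auto
    obtain l where "l \<in> {1,2,3}" "P \<in> F l" "C \<in> F l" using row[OF L Cx(2-4)] Cx(1) by auto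
    then have "C \<in> F i" using m_sets_unique[OF L(1) i(1)] i(2)[OF L(1)] by metis
    moreover have "\<forall>j\<in>{1,2,3} - {i}. C \<notin> F j"
      using m_sets_conflict_superset[OF i(1) _ _ L(1) i(2)[OF L(1)] P(1) C(2)] by auto
    ultimately show ?thesis ..
  qed
  have eqi: "F i = {A. A \<subseteq> U \<and> m \<le> card A \<and> card A \<le> 2 * m + 1}"
  proof (intro equalityI subsetI)
    fix A assume A: "A \<in> {A. A \<subseteq> U \<and> m \<le> card A \<and> card A \<le> 2 * m + 1}"
    then consider "card A = m" | "m + 1 \<le> card A" "card A \<le> 2 * m" | "card A = 2 * m + 1" by force
    then show "A \<in> F i"
      using A i(2)[of A] middle[OF i(1), of A] top[of A] by cases (auto simp: m_sets_def)
  qed (use range[OF _ i(1)] in blast)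
  have eqj: "F j = {A. A \<subseteq> U \<and> m + 1 \<le> card A \<and> card A \<le> 2 * m}" if j: "j \<in> {1,2,3}" "j \<noteq> i" for j
  proof (intro equalityI subsetI)
    fix A assume A: "A \<in> F j"
    have r: "A \<subseteq> U" "m \<le> card A" "card A \<le> 2 * m + 1" using range[OF A j(1)] by auto
    have "card A \<noteq> m" using m_sets_unique[of A i j] i A j r by (auto simp: m_sets_def)
    moreover have "card A \<noteq> 2 * m + 1" using top[of A] r j A by auto
    ultimately show "A \<in> {A. A \<subseteq> U \<and> m + 1 \<le> card A \<and> card A \<le> 2 * m}" using r by auto
  qed (use middle[OF j(1)] in blast)
  show thesis by (rule that[OF i(1) eqi eqj])
qed

end

section \<open>The bound and its case of equality\<close>

lemma card_K_family:
  "card (K_family m) = (\<Sum>k=m+1..2*m+1. 3 * m choose k)"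
proof -
  have "K_family m = (\<Union>k\<in>{m+1..2*m+1}. {K. K \<subseteq> {1..3*m} \<and> card K = k})"
    by (auto simp: K_family_def)
  then have "card (K_family m) = card (\<Union>k\<in>{m+1..2*m+1}. {K. K \<subseteq> {1..3*m} \<and> card K = k})" by simp
  also have "\<dots> = (\<Sum>k=m+1..2*m+1. card {K. K \<subseteq> {1..3*m} \<and> card K = k})"
    by (rule card_UN_disjoint) auto
  finally show ?thesis by (simp only: n_subsets finite_atLeastAtMost card_atLeastAtMost diff_Suc_1 simp_thms)
qed

theorem theorem4:
  fixes m n :: nat and F :: "nat \<Rightarrow> nat set set"
  assumes "n = 3 * m" and "n \<ge> 18"
    and "\<forall>i\<in>{1, 2, 3}. F i \<subseteq> Pow {1..n}"
    and "cross_partition_free (F 1) (F 2) (F 3)"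
  shows "real (card (F 1)) + real (card (F 2)) + real (card (F 3))
           \<le> 3 * real (card (K_family m)) + 1 / real m * real ((3 * m) choose (2 * m + 1))
       \<and> (real (card (F 1)) + real (card (F 2)) + real (card (F 3))
           = 3 * real (card (K_family m)) + 1 / real m * real ((3 * m) choose (2 * m + 1))
          \<longrightarrow> (\<exists>p. p permutes {1, 2, 3}
                 \<and> F (p 1) = {A. A \<subseteq> {1..n} \<and> m \<le> card A \<and> card A \<le> 2 * m + 1}
                 \<and> F (p 2) = {B. B \<subseteq> {1..n} \<and> m + 1 \<le> card B \<and> card B \<le> 2 * m}
                 \<and> F (p 3) = {B. B \<subseteq> {1..n} \<and> m + 1 \<le> card B \<and> card B \<le> 2 * m}))"
    (is "?S \<le> ?B \<and> (?S = ?B \<longrightarrow> _)")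
proof -
  interpret cross_free_triple "{1..n}" F
    by unfold_locales (use assms in auto)
  have m: "m \<ge> 6" using assms(1,2) by simp
  have cU: "card {1..n} = 3 * m" using assms(1) by simp
  define C where "C = real (3 * m choose (2 * m + 1))"
  have C: "C > 0" using m by (simp add: C_def)
  \<comment> \<open>One configuration suffices, as \<open>mean_excess m\<close> does not depend on
    it.\<close>
  have "config m {1..m} {m+1..2*m} {2*m+2..3*m} (2 * m + 1)"
    unfolding config_def using assms(1) m by auto
  then have \<rho>: "mean_excess m \<le> 0" using mean_excess_nonpos(1) m by blast
  let ?G = "\<Sum>k=m+1..2*m. gap k"
  have "?S \<le> 3 * (\<Sum>k=m+1..2*m+1. real (3 * m choose k)) + C / m + C * mean_excess m - C / (3 * m) * ?G"
    unfolding sum_card_eq cU C_def mean_excess_def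
    by (rule weighted_sum_le[OF m gap_def gap_nonneg[unfolded cU] three_layers[unfolded cU]])
  then have main: "?S \<le> ?B + C * mean_excess m - C / (3 * m) * ?G"
    by (simp add: card_K_family C_def)
  have gap: "0 \<le> gap k" if "k \<in> {m+1..2*m}" for k
    using that cU by (intro gap_nonneg) auto
  then have G: "0 \<le> ?G" by (rule sum_nonneg)
  have \<rho>': "C * mean_excess m \<le> 0" and G': "0 \<le> C / (3 * m) * ?G"
    using \<rho> C G by (simp_all add: mult_nonneg_nonpos)
  have "\<exists>p. p permutes {1, 2, 3}
      \<and> F (p 1) = {A. A \<subseteq> {1..n} \<and> m \<le> card A \<and> card A \<le> 2 * m + 1}
      \<and> F (p 2) = {B. B \<subseteq> {1..n} \<and> m + 1 \<le> card B \<and> card B \<le> 2 * m}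
      \<and> F (p 3) = {B. B \<subseteq> {1..n} \<and> m + 1 \<le> card B \<and> card B \<le> 2 * m}" if eq: "?S = ?B"
  proof -
    \<comment> \<open>Both corrections in \<open>main\<close> only lower the bound, so equality
      forces each to vanish.\<close>
    have 0: "C * mean_excess m = 0" "C / (3 * m) * ?G = 0" using main eq \<rho>' G' by linarith+
    then have "?G = 0" "mean_excess m = 0" using C m by auto
    then have "gap k = 0" if "k \<in> {m+1..2*m}" for k
      using that gap sum_nonneg_eq_0_iff[of "{m+1..2*m}" gap] by auto
    then interpret extremal_triple "{1..n}" F m
      by unfold_locales (use cU m \<open>mean_excess m = 0\<close> in auto)
    obtain i where i: "i \<in> {1,2,3}" "F i = {A. A \<subseteq> {1..n} \<and> m \<le> card A \<and> card A \<le> 2 * m + 1}"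
      "\<And>j. j \<in> {1,2,3} \<Longrightarrow> j \<noteq> i \<Longrightarrow> F j = {A. A \<subseteq> {1..n} \<and> m + 1 \<le> card A \<and> card A \<le> 2 * m}"
      using extremal_structure by blast
    let ?p = "Transposition.transpose 1 i"
    have p: "?p permutes {1,2,3}" using i(1) by (intro permutes_swap_id) auto
    have "?p 2 \<in> {1,2,3}" "?p 3 \<in> {1,2,3}" "?p 2 \<noteq> i" "?p 3 \<noteq> i"
      using i(1) by (auto simp: Transposition.transpose_def)
    then show ?thesis using p i(2,3) by (intro exI[of _ ?p]) auto
  qed
  moreover have "?S \<le> ?B" using main \<rho>' G' by linarith
  ultimately show ?thesis by blast
qed

end
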